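(* Let $\mathcal{P}_1,\mathcal{P}_2\subset\mathbb{R}^n$ be full-dimensional anti-blocking polytopes with subdivisions $\mathcal{S}_1$ and $\mathcal{S}_2$, respectively. For $J\subseteq[n]$ let $\mathcal{S}_i|_J=\{S\cap\mathcal{P}_i|_J:S\in\mathcal{S}_i\}$. Then \[\mathcal{S}=\bigcup_{J\subseteq[n]}\mathcal{S}_1|_J*\mathcal{S}_2|_{J^c},\qquad \mathcal{S}_1|_J*\mathcal{S}_2|_{J^c}=\{S*T: S\in\mathcal{S}_1|_J,\ T\in\mathcal{S}_2|_{J^c}\},\] is a subdivision of $\operatorname{conv}(\mathcal{P}_1\times\{1\}\cup-\mathcal{P}_2\times\{-1\})$. Moreover: (i) if $\mathcal{S}_1,\mathcal{S}_2$ are regular, then $\mathcal{S}$ is regular; (ii) if $\mathcal{S}_1,\mathcal{S}_2$ are unimodular triangulations with respect to a lattice $\Lambda$, then $\mathcal{S}$ is a unimodular triangulation with respect to the affine lattice $\Lambda\times(2\mathbb{Z}+1)$; (iii) if $\mathcal{S}_1,\mathcal{S}_2$ are flag, then $\mathcal{S}$ is flag.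
   Context: A polytope $\mathcal{P}\subseteq\mathbb{R}^n_{\ge0}$ is anti-blocking if $q\in\mathcal{P}$, $0\le p\le q$ imply $p\in\mathcal{P}$. For $J\subseteq[n]$, $\mathcal{P}|_J=\{x\in\mathcal{P}:x_j=0\text{ for }j\notin J\}$, $J^c=[n]\setminus J$. A subdivision of a polytope is a collection of full-dimensional (relative to the polytope) polytopes covering it and pairwise meeting in common faces; regular means induced by a height function. A triangulation is a subdivision into simplices without new vertices; it is unimodular with respect to an (affine) lattice if every maximal simplex has minimal possible volume among lattice simplices (normalized volume $1$), and flag if every minimal non-face has exactly two vertices. For $S,T$ the join is $S*T=\operatorname{conv}(S\times\{1\}\cup -T\times\{-1\})\subset\mathbb{R}^n\times\mathbb{R}$.
   Formalization: In (ii) unimodularity is claimed only for lattices Λ closed under coordinate projections (it fails otherwise, e.g. Λ=Z³+Z(½,½,½)); and "S is a subdivision" means its full-dimensional members form one, all other members being faces of these. *)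

theory Defs
  imports "HOL-Analysis.Analysis"
begin

section \<open>Subdivisions, triangulations\<close>

text \<open>A subdivision is given by its maximal cells; \<^const>\<open>face_of\<close> admits the empty face.\<close>

definition subdivision :: "'a::euclidean_space set \<Rightarrow> 'a set set \<Rightarrow> bool" where
  "subdivision P S \<longleftrightarrow>
     finite S \<and>
     (\<forall>C\<in>S. polytope C \<and> aff_dim C = aff_dim P) \<and>
     \<Union>S = P \<and>
     (\<forall>C\<in>S. \<forall>D\<in>S. C \<inter> D face_of C \<and> C \<inter> D face_of D)"

definition full_cells :: "'a::euclidean_space set \<Rightarrow> 'a set set \<Rightarrow> 'a set set" where
  "full_cells P S = {C \<in> S. aff_dim C = aff_dim P}"

definition lower_face :: "('a::euclidean_space \<times> real) set \<Rightarrow> ('a \<times> real) set \<Rightarrow> bool" where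
  "lower_face Q F \<longleftrightarrow>
     (\<exists>c b. (\<forall>(x, t)\<in>Q. c \<bullet> x + b \<le> t) \<and> F = {(x, t)\<in>Q. t = c \<bullet> x + b})"

text \<open>The finite set \<open>A\<close> carrying the heights may contain points that are not vertices of \<open>P\<close>,
  since the cells of a subdivision may have vertices that are not vertices of \<open>P\<close>.\<close>

definition regular_subdivision :: "'a::euclidean_space set \<Rightarrow> 'a set set \<Rightarrow> bool" where
  "regular_subdivision P S \<longleftrightarrow>
     subdivision P S \<and>
     (\<exists>A \<omega>. finite A \<and> convex hull A = P \<and>
        S = full_cells P {fst ` F | F. lower_face (convex hull ((\<lambda>a. (a, \<omega> a)) ` A)) F})"

definition verts :: "'a::euclidean_space set \<Rightarrow> 'a set" where
  "verts C = {v. v extreme_point_of C}"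

definition triangulation_of :: "'a::euclidean_space set \<Rightarrow> 'a set set \<Rightarrow> bool" where
  "triangulation_of P S \<longleftrightarrow>
     subdivision P S \<and> triangulation S \<and> (\<forall>C\<in>S. verts C \<subseteq> verts P)"

definition is_face :: "'a::euclidean_space set set \<Rightarrow> 'a set \<Rightarrow> bool" where
  "is_face S \<sigma> \<longleftrightarrow> (\<exists>C\<in>S. \<sigma> \<subseteq> verts C)"

definition minimal_nonface :: "'a::euclidean_space set set \<Rightarrow> 'a set \<Rightarrow> bool" where
  "minimal_nonface S \<sigma> \<longleftrightarrow>
     \<sigma> \<subseteq> (\<Union>C\<in>S. verts C) \<and> \<not> is_face S \<sigma> \<and> (\<forall>\<tau>. \<tau> \<subset> \<sigma> \<longrightarrow> is_face S \<tau>)"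

definition flag_triangulation :: "'a::euclidean_space set \<Rightarrow> 'a set set \<Rightarrow> bool" where
  "flag_triangulation P S \<longleftrightarrow>
     triangulation_of P S \<and> (\<forall>\<sigma>. minimal_nonface S \<sigma> \<longrightarrow> card \<sigma> = 2)"

section \<open>Lattices and unimodularity\<close>

definition full_lattice :: "'a::euclidean_space set \<Rightarrow> bool" where
  "full_lattice \<Lambda> \<longleftrightarrow>
     (\<exists>B. independent B \<and> span B = UNIV \<and>
        \<Lambda> = {\<Sum>b\<in>B. real_of_int (k b) *\<^sub>R b | k :: 'a \<Rightarrow> int. True})"

definition affine_lattice :: "'a::euclidean_space set \<Rightarrow> bool" where
  "affine_lattice L \<longleftrightarrow> (\<exists>t \<Lambda>. full_lattice \<Lambda> \<and> L = (+) t ` \<Lambda>)"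

definition lattice_simplex :: "'a::euclidean_space set \<Rightarrow> 'a set \<Rightarrow> bool" where
  "lattice_simplex L C \<longleftrightarrow> int DIM('a) simplex C \<and> verts C \<subseteq> L"

definition unimodular_simplex :: "'a::euclidean_space set \<Rightarrow> 'a set \<Rightarrow> bool" where
  "unimodular_simplex L C \<longleftrightarrow>
     lattice_simplex L C \<and>
     (\<forall>D. lattice_simplex L D \<longrightarrow> measure lebesgue C \<le> measure lebesgue D)"

definition unimodular_triangulation ::
    "'a::euclidean_space set \<Rightarrow> 'a set \<Rightarrow> 'a set set \<Rightarrow> bool" where
  "unimodular_triangulation L P S \<longleftrightarrow>
     affine_lattice L \<and> triangulation_of P S \<and> (\<forall>C\<in>S. unimodular_simplex L C)"

definition odd_ints :: "real set" where
  "odd_ints = {real_of_int k | k. odd k}"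

text \<open>\<open>\<Lambda> = (\<Lambda> \<inter> \<real>\<^sup>J) \<oplus> (\<Lambda> \<inter> \<real>\<^bsup>-J\<^esup>)\<close> for every coordinate set \<open>J\<close>, equivalently \<open>\<Lambda>\<close> is
  closed under the coordinate projections. Without this the joined triangulation
  need not be unimodular: for \<open>n = 3\<close>, \<open>h = (1/2,1/2,1/2)\<close> and \<open>\<Lambda> = \<int>\<^sup>3 + \<int>h\<close>, the anti-blocking polytope
  \<open>conv {0,e1,e2,e3,h}\<close> has the unimodular triangulation with cells \<open>conv {0,h,ei,ej}\<close>, but
  for \<open>J = {1,2}\<close> the join of \<open>conv {0,e1,e2}\<close> and \<open>conv {0,e3}\<close> has normalized volume 2.\<close>

definition coordinate_split :: "(real^'n) set \<Rightarrow> bool" where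
  "coordinate_split \<Lambda> \<longleftrightarrow> (\<forall>x\<in>\<Lambda>. \<forall>J. (\<chi> i. if i \<in> J then x $ i else 0) \<in> \<Lambda>)"

section \<open>Anti-blocking polytopes and joins\<close>

definition anti_blocking :: "(real^'n) set \<Rightarrow> bool" where
  "anti_blocking P \<longleftrightarrow>
     polytope P \<and> (\<forall>q\<in>P. 0 \<le> q) \<and> (\<forall>q\<in>P. \<forall>p. 0 \<le> p \<and> p \<le> q \<longrightarrow> p \<in> P)"

definition coord_restrict :: "(real^'n) set \<Rightarrow> 'n set \<Rightarrow> (real^'n) set" where
  "coord_restrict P J = {x \<in> P. \<forall>j. j \<notin> J \<longrightarrow> x $ j = 0}"

definition restrict_cells ::
    "(real^'n) set \<Rightarrow> (real^'n) set set \<Rightarrow> 'n set \<Rightarrow> (real^'n) set set" where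
  "restrict_cells P S J = {C \<inter> coord_restrict P J | C. C \<in> S}"

definition poly_join :: "(real^'n) set \<Rightarrow> (real^'n) set \<Rightarrow> ((real^'n) \<times> real) set" where
  "poly_join S T = convex hull (S \<times> {1} \<union> (uminus ` T) \<times> {-1})"

definition join_cells ::
    "(real^'n) set set \<Rightarrow> (real^'n) set set \<Rightarrow> ((real^'n) \<times> real) set set" where
  "join_cells \<S> \<T> = {poly_join S T | S T. S \<in> \<S> \<and> T \<in> \<T>}"

end

theory Submission
  imports Defs "HOL-Analysis.Simplex_Content"
begin

text \<open>By anti-blocking, a point \<open>(x, t)\<close> lies in the big polytope iff \<open>x\<^sup>+ \<in> \<lambda>P\<^sub>1\<close> and
  \<open>x\<^sup>- \<in> (1 - \<lambda>)P\<^sub>2\<close>, where \<open>\<lambda> = (1 + t)/2\<close>; membership in a cell \<open>S * T\<close> is the same condition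
  with \<open>S\<close> and \<open>T\<close>. Hence intersections of cells are joins of intersections, and because \<open>S\<close> and \<open>T\<close>
  live in complementary coordinate subspaces, joins of faces are faces and dimensions add up.
  For regularity, the heights \<open>\<omega>\<^sub>1(a) + M \<Sum>a\<close> at \<open>(a, 1)\<close> and \<open>\<omega>\<^sub>2(b) + M \<Sum>b\<close> at \<open>(-b, -1)\<close> induce the
  joined subdivision once \<open>M\<close> is large. For unimodularity, a lattice simplex has minimal volume iff
  its vertices generate the lattice affinely, and affine coordinates of a split lattice point are read
  off in the two factors. A set of vertices whose pairs are faces has disjointly supported parts in
  the two factors, each a face, which gives flagness.\<close>

section \<open>Joins in complementary coordinate subspaces\<close>

text \<open>Cells for different \<open>J\<close> must be compared, and this is why joins have two
  membership tests. \<open>poly_join_coord_iff\<close> depends on \<open>J\<close> but is affine in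
  the point, so it transports faces. \<open>poly_join_pos_part_iff\<close> is not linear but free of
  \<open>J\<close>, so it computes intersections. The union in the theorem also contains joins of
  lower-dimensional or empty restrictions, while \<open>subdivision\<close> lists maximal cells
  only. So the full-dimensional restrictions are shown to cover the restricted polytope and to
  contain each other restriction as a face; the dimensions \<open>card J\<close> and
  \<open>card (- J)\<close> then give a join of dimension \<open>n + 1\<close>. For regularity, one
  linear functional serves both heights. In coordinate \<open>i\<close> height 1 asks for slope
  \<open>c1_i + M\<close> and height -1 for \<open>- c2_i - M\<close>; \<open>J\<close> decides
  which is met, and the missed one costs \<open>c1_i + c2_i + 2M\<close> per unit, which
  \<open>M\<close> must make positive for all pairs of cells. Unimodularity is defined by volume, so
  its lattice form is needed both ways: from the cells of the factors to integral coordinates, and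
  from integral coordinates back to the join. Faces of cells inherit integrality by padding
  coefficients with zero.\<close>

definition coord_space :: "'n set \<Rightarrow> (real^'n) set" where
  "coord_space J = {x. \<forall>j. j \<notin> J \<longrightarrow> x $ j = 0}"

definition coord_proj :: "'n set \<Rightarrow> real^'n \<Rightarrow> real^'n" where
  "coord_proj J x = (\<chi> i. if i \<in> J then x $ i else 0)"

lemma coord_proj_nth [simp]: "coord_proj J x $ i = (if i \<in> J then x $ i else 0)"
  by (simp add: coord_proj_def)

lemma linear_coord_proj: "linear (coord_proj J)"
  by (rule linearI) (auto simp: vec_eq_iff)

lemma coord_proj_in_coord_space: "coord_proj J x \<in> coord_space J"
  by (simp add: coord_space_def)

lemma coord_proj_eq_iff: "coord_proj J x = x \<longleftrightarrow> x \<in> coord_space J"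
  by (auto simp: vec_eq_iff coord_space_def)

lemma coord_restrict_eq: "coord_restrict P J = P \<inter> coord_space J"
  by (auto simp: coord_restrict_def coord_space_def)

lemma subspace_coord_space: "subspace (coord_space J)"
  by (auto simp: subspace_def coord_space_def)

lemma convex_coord_space: "convex (coord_space J)"
  by (simp add: subspace_coord_space subspace_imp_convex)

lemma dim_coord_space: "dim (coord_space J) = card J"
  unfolding coord_space_def using dim_substandard_cart[where 'a=real] by (simp add: dim_vec_eq)

text \<open>Each hyperplane \<open>x_j = 0\<close> supports a nonnegative set, and an intersection
  of faces is a face.\<close>

lemma face_of_Int_coord_space:
  fixes S :: "(real^'n) set"
  assumes "convex S" "\<And>x. x \<in> S \<Longrightarrow> 0 \<le> x"
  shows "S \<inter> coord_space J face_of S"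
proof -
  have "S \<inter> {x. axis j 1 \<bullet> x = 0} face_of S" for j
    using assms by (intro face_of_Int_supporting_hyperplane_ge)
      (auto simp: less_eq_vec_def inner_axis')
  \<comment> \<open>Inserting \<open>S\<close> keeps the family nonempty when \<open>J\<close>
    contains every coordinate.\<close>
  then have "\<Inter> (insert S ((\<lambda>j. S \<inter> {x. axis j 1 \<bullet> x = 0}) ` (- J))) face_of S"
    using assms(1) by (intro face_of_Inter) (auto simp: face_of_refl)
  moreover have "\<Inter> (insert S ((\<lambda>j. S \<inter> {x. axis j 1 \<bullet> x = 0}) ` (- J))) = S \<inter> coord_space J"
    by (auto simp: coord_space_def inner_axis')
  ultimately show ?thesis by simp
qed

text \<open>The cone over \<open>S \<times> {1}\<close>. The apex always belongs to it, even if \<open>S\<close> is empty, so that the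
  description of joins below covers the case of an empty factor.\<close>

definition cone_over :: "'a::real_vector set \<Rightarrow> ('a \<times> real) set" where
  "cone_over S = {(y, l). l = 0 \<and> y = 0 \<or> l > 0 \<and> inverse l *\<^sub>R y \<in> S}"

lemma cone_over_iff:
  "(y, l) \<in> cone_over S \<longleftrightarrow> l = 0 \<and> y = 0 \<or> l > 0 \<and> (\<exists>p\<in>S. y = l *\<^sub>R p)"
  by (force simp: cone_over_def)

lemma cone_over_Int: "cone_over (S \<inter> T) = cone_over S \<inter> cone_over T"
  by (auto simp: cone_over_def)

lemma cone_over_mono: "S \<subseteq> T \<Longrightarrow> cone_over S \<subseteq> cone_over T"
  by (auto simp: cone_over_def)

lemma cone_over_nonneg: "(y, l) \<in> cone_over S \<Longrightarrow> 0 \<le> l"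
  by (auto simp: cone_over_def)

lemma cone_over_scale: "0 \<le> c \<Longrightarrow> (y, l) \<in> cone_over S \<Longrightarrow> (c *\<^sub>R y, c * l) \<in> cone_over S"
  by (cases "c = 0") (auto simp: cone_over_iff)

lemma cone_over_add:
  assumes "convex S" "(y, l) \<in> cone_over S" "(z, m) \<in> cone_over S"
  shows "(y + z, l + m) \<in> cone_over S"
proof (cases "l = 0 \<or> m = 0")
  case True
  with assms show ?thesis by (auto simp: cone_over_iff)
next
  case False
  with assms obtain p q where pq: "p \<in> S" "q \<in> S" "y = l *\<^sub>R p" "z = m *\<^sub>R q" "l > 0" "m > 0"
    by (auto simp: cone_over_iff)
  have "(l / (l + m)) *\<^sub>R p + (m / (l + m)) *\<^sub>R q \<in> S"
    using pq assms(1) by (intro convexD) (auto simp flip: add_divide_distrib)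
  moreover have "y + z = (l + m) *\<^sub>R ((l / (l + m)) *\<^sub>R p + (m / (l + m)) *\<^sub>R q)"
    using pq by (simp add: scaleR_add_right)
  ultimately show ?thesis using pq by (auto simp: cone_over_iff)
qed

lemma convex_cone_over: "convex S \<Longrightarrow> convex (cone_over S)"
  by (force intro!: convexI cone_over_add cone_over_scale)

text \<open>A segment between two cone points of positive height rescales to a segment in the base;
  if one end is the apex, the other is a positive multiple of the point in
  \<open>cone_over F\<close>.\<close>

lemma face_of_cone_over:
  assumes F: "F face_of S" and S: "convex S"
  shows "cone_over F face_of cone_over S"
proof -
  have "(y, l) \<in> cone_over F \<and> (z, m) \<in> cone_over F"
    if yz: "(y, l) \<in> cone_over S" "(z, m) \<in> cone_over S"
      and uv: "0 < u" "0 < v" "(u *\<^sub>R y + v *\<^sub>R z, u * l + v * m) \<in> cone_over F" for y z l m u v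
  proof -
    consider "l = 0" "m = 0" | "l = 0" "m > 0" | "l > 0" "m = 0" | "l > 0" "m > 0"
      using cone_over_nonneg[OF yz(1)] cone_over_nonneg[OF yz(2)] by linarith
    then show ?thesis
    proof cases
      case 4
      then obtain p q where pq: "p \<in> S" "q \<in> S" "y = l *\<^sub>R p" "z = m *\<^sub>R q"
        using yz by (auto simp: cone_over_iff)
      \<comment> \<open>Dividing by the total height \<open>w\<close> turns the combination into a
        convex combination of \<open>p\<close> and \<open>q\<close> with weights
        \<open>u * l / w\<close> and \<open>v * m / w\<close>.\<close>
      define w where "w = u * l + v * m"
      have w: "0 < u * l" "0 < v * m" "w > 0" using 4 uv by (auto simp: w_def add_pos_pos)
      obtain f where f: "f \<in> F" "u *\<^sub>R y + v *\<^sub>R z = w *\<^sub>R f"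
        using uv w by (auto simp: cone_over_iff w_def)
      have "f = inverse w *\<^sub>R (w *\<^sub>R f)" using w by simp
      also have "\<dots> = (u * l / w) *\<^sub>R p + (v * m / w) *\<^sub>R q"
        unfolding f(2)[symmetric] pq by (simp add: scaleR_add_right divide_inverse mult.commute)
      also have "u * l / w = 1 - v * m / w" using w by (simp add: w_def field_simps)
      finally have fe: "f = (1 - v * m / w) *\<^sub>R p + (v * m / w) *\<^sub>R q" .
      have "0 < v * m / w" "v * m / w < 1" using w by (auto simp: w_def field_simps)
      then have "p = q \<or> f \<in> open_segment p q" using fe by (auto simp: in_segment)
      then have "p \<in> F \<and> q \<in> F"
        using face_ofD[OF F] pq f fe by (force simp: algebra_simps)
      then show ?thesis using pq 4 by (auto simp: cone_over_iff)
    qed (use yz uv in \<open>auto simp: cone_over_iff\<close>)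
  qed
  note key = this
  show ?thesis
    unfolding face_of_def
  proof (intro conjI ballI impI)
    show "cone_over F \<subseteq> cone_over S" by (rule cone_over_mono[OF face_of_imp_subset[OF F]])
    show "convex (cone_over F)" by (rule convex_cone_over[OF face_of_imp_convex[OF F]])
    fix a b x assume h: "a \<in> cone_over S" "b \<in> cone_over S" "x \<in> cone_over F" "x \<in> open_segment a b"
    obtain y l z m where ab: "a = (y, l)" "b = (z, m)" by fastforce
    from h obtain u where u: "0 < u" "u < 1" "x = (1 - u) *\<^sub>R a + u *\<^sub>R b"
      by (auto simp: in_segment)
    show "a \<in> cone_over F" "b \<in> cone_over F"
      using key[of y l z m "1 - u" u] h(1-3) u(1,2) unfolding u(3) ab by simp_all
  qed
qed

section \<open>Membership in joins, faces of joins\<close>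

text \<open>In a convex combination of \<open>(p, 1)\<close> and \<open>(- q, - 1)\<close> the
  height \<open>t\<close> forces the weights \<open>(1 + t) / 2\<close> and
  \<open>(1 - t) / 2\<close>; \<open>y\<close> and \<open>z\<close> are the weighted
  \<open>p\<close> and \<open>q\<close>. The right-hand side defines a convex set containing the
  generators.\<close>

lemma poly_join_iff:
  fixes S T :: "(real^'n) set"
  assumes "convex S" "convex T"
  shows "(x, t) \<in> poly_join S T \<longleftrightarrow>
    (\<exists>y z. x = y - z \<and> (y, (1 + t) / 2) \<in> cone_over S \<and> (z, (1 - t) / 2) \<in> cone_over T)"
proof -
  define R where "R = {(x, t). \<exists>y z. x = y - z \<and> (y, (1 + t) / 2) \<in> cone_over S
     \<and> (z, (1 - t) / 2) \<in> cone_over T}"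
  have "convex R"
  proof (rule convexI)
    fix a b :: "(real^'n) \<times> real" and u v :: real
    assume ab: "a \<in> R" "b \<in> R" and uv: "0 \<le> u" "0 \<le> v" "u + v = 1"
    obtain x t x' t' where eq: "a = (x, t)" "b = (x', t')" by fastforce
    from ab obtain y z y' z' where h:
      "x = y - z" "(y, (1 + t) / 2) \<in> cone_over S" "(z, (1 - t) / 2) \<in> cone_over T"
      "x' = y' - z'" "(y', (1 + t') / 2) \<in> cone_over S" "(z', (1 - t') / 2) \<in> cone_over T"
      by (auto simp: R_def eq)
    have "(u *\<^sub>R y + v *\<^sub>R y', u * ((1 + t) / 2) + v * ((1 + t') / 2)) \<in> cone_over S"
         "(u *\<^sub>R z + v *\<^sub>R z', u * ((1 - t) / 2) + v * ((1 - t') / 2)) \<in> cone_over T"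
      using h uv assms by (intro cone_over_add cone_over_scale; simp)+
    moreover have "u * ((1 + t) / 2) + v * ((1 + t') / 2) = (1 + (u * t + v * t')) / 2"
      "u * ((1 - t) / 2) + v * ((1 - t') / 2) = (1 - (u * t + v * t')) / 2"
      using uv by (simp_all add: field_simps)
    moreover have "u *\<^sub>R x + v *\<^sub>R x' = (u *\<^sub>R y + v *\<^sub>R y') - (u *\<^sub>R z + v *\<^sub>R z')"
      by (simp add: h algebra_simps)
    ultimately have "(u *\<^sub>R x + v *\<^sub>R x', u * t + v * t') \<in> R"
      unfolding R_def mem_Collect_eq case_prod_conv by metis
    then show "u *\<^sub>R a + v *\<^sub>R b \<in> R" by (simp add: eq)
  qed
  moreover have "S \<times> {1} \<union> uminus ` T \<times> {-1} \<subseteq> R"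
    by (auto simp: R_def cone_over_iff)
  ultimately have 1: "poly_join S T \<subseteq> R"
    unfolding poly_join_def by (intro hull_minimal)
  have 2: "(x, t) \<in> poly_join S T" if "x = y - z"
    and y: "(y, (1 + t) / 2) \<in> cone_over S" and z: "(z, (1 - t) / 2) \<in> cone_over T" for y z
  proof -
    let ?X = "S \<times> {1} \<union> uminus ` T \<times> {-1::real}"
    \<comment> \<open>At the extreme heights one weight is 0 and that factor contributes the apex,
      even if it is empty.\<close>
    consider "t = 1" | "t = -1" | "-1 < t" "t < 1"
      using cone_over_nonneg[OF y] cone_over_nonneg[OF z] by fastforce
    then show ?thesis
    proof cases
      case 3
      then obtain p q where pq: "p \<in> S" "q \<in> T" "y = ((1+t)/2) *\<^sub>R p" "z = ((1-t)/2) *\<^sub>R q"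
        using y z by (auto simp: cone_over_iff)
      have "((1+t)/2) *\<^sub>R (p, 1) + ((1-t)/2) *\<^sub>R (- q, - 1) \<in> convex hull ?X"
        using pq 3 by (intro convexD[OF convex_convex_hull] hull_inc) (auto simp: field_simps)
      moreover have "((1+t)/2) *\<^sub>R (p, 1) + ((1-t)/2) *\<^sub>R (- q, - 1) = (x, t)"
        using that pq by (simp add: field_simps)
      ultimately show ?thesis unfolding poly_join_def by simp
    qed (use that in \<open>auto simp: cone_over_iff poly_join_def intro!: hull_inc\<close>)
  qed
  from 1 2 show ?thesis unfolding R_def by fastforce
qed

lemma cone_over_coord_space:
  "(y, l) \<in> cone_over S \<Longrightarrow> S \<subseteq> coord_space J \<Longrightarrow> y \<in> coord_space J"
  by (auto simp: cone_over_iff coord_space_def subset_iff)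

text \<open>Complementary supports leave only one decomposition \<open>x = y - z\<close>, so the
  existential becomes two separate cone conditions, each affine in \<open>(x, t)\<close>.\<close>

lemma poly_join_coord_iff:
  assumes "convex S" "convex T" "S \<subseteq> coord_space J" "T \<subseteq> coord_space (- J)"
  shows "(x, t) \<in> poly_join S T \<longleftrightarrow>
    (coord_proj J x, (1 + t) / 2) \<in> cone_over S \<and> (- coord_proj (- J) x, (1 - t) / 2) \<in> cone_over T"
proof -
  have "coord_proj J x = y \<and> - coord_proj (- J) x = z"
    if "x = y - z" "(y, (1 + t) / 2) \<in> cone_over S" "(z, (1 - t) / 2) \<in> cone_over T" for y z
  proof -
    have "y \<in> coord_space J" "z \<in> coord_space (- J)"
      using that assms cone_over_coord_space by blast+
    then show ?thesis using that(1) by (auto simp: vec_eq_iff coord_space_def)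
  qed
  moreover have "x = coord_proj J x - (- coord_proj (- J) x)" by (auto simp: vec_eq_iff)
  ultimately show ?thesis unfolding poly_join_iff[OF assms(1,2)] by metis
qed

text \<open>The join is the set where the affine maps \<open>A\<close> and \<open>B\<close> land in
  the two cones, so the face property is pulled back from the cones.\<close>

lemma face_of_poly_join:
  assumes F: "F face_of S" and G: "G face_of T" and cvx: "convex S" "convex T"
    and J: "S \<subseteq> coord_space J" "T \<subseteq> coord_space (- J)"
  shows "poly_join F G face_of poly_join S T"
proof -
  have FG: "convex F" "convex G" "F \<subseteq> S" "G \<subseteq> T"
    using F G face_of_imp_convex face_of_imp_subset by blast+
  define A B where "A = (\<lambda>(x, t). (coord_proj J x, (1 + t) / 2 :: real))"
    and "B = (\<lambda>(x, t). (- coord_proj (- J) x, (1 - t) / 2 :: real))"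
  have ST: "z \<in> poly_join S T \<longleftrightarrow> A z \<in> cone_over S \<and> B z \<in> cone_over T" for z
    using poly_join_coord_iff[OF cvx J] by (cases z) (simp add: A_def B_def)
  have FG': "z \<in> poly_join F G \<longleftrightarrow> A z \<in> cone_over F \<and> B z \<in> cone_over G" for z
    using poly_join_coord_iff[OF FG(1,2), of J] FG J by (cases z) (auto simp: A_def B_def)
  have AB: "A ((1 - u) *\<^sub>R a + u *\<^sub>R b) = (1 - u) *\<^sub>R A a + u *\<^sub>R A b"
    "B ((1 - u) *\<^sub>R a + u *\<^sub>R b) = (1 - u) *\<^sub>R B a + u *\<^sub>R B b" for a b u
    by (auto simp: A_def B_def split_beta vec_eq_iff field_simps)
  have face: "a \<in> cone_over H \<and> b \<in> cone_over H"
    if "H face_of K" "convex K" "a \<in> cone_over K" "b \<in> cone_over K" "0 < u" "u < 1"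
      "(1 - u) *\<^sub>R a + u *\<^sub>R b \<in> cone_over H"
    for H K :: "(real^'n) set" and a b u
  \<comment> \<open>\<open>A\<close> or \<open>B\<close> may identify distinct points, and an open
    segment with equal ends is empty.\<close>
  proof (cases "a = b")
    case True
    with that show ?thesis by (simp flip: scaleR_add_left)
  next
    case False
    then have "(1 - u) *\<^sub>R a + u *\<^sub>R b \<in> open_segment a b" using that by (auto simp: in_segment)
    then show ?thesis using face_ofD[OF face_of_cone_over] that by blast
  qed
  show ?thesis unfolding face_of_def
  proof (intro conjI ballI impI)
    show "poly_join F G \<subseteq> poly_join S T"
      unfolding poly_join_def using FG by (intro hull_mono) auto
    show "convex (poly_join F G)" by (simp add: poly_join_def)
    fix a b x assume "a \<in> poly_join S T" "b \<in> poly_join S T" "x \<in> poly_join F G" "x \<in> open_segment a b"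
    then obtain u where u: "0 < u" "u < 1" "(1 - u) *\<^sub>R A a + u *\<^sub>R A b \<in> cone_over F"
      "(1 - u) *\<^sub>R B a + u *\<^sub>R B b \<in> cone_over G" "A a \<in> cone_over S" "A b \<in> cone_over S"
      "B a \<in> cone_over T" "B b \<in> cone_over T"
      by (auto simp: ST FG' AB in_segment)
    then show "a \<in> poly_join F G" "b \<in> poly_join F G"
      unfolding FG' using face[OF F cvx(1) u(5,6,1,2,3)] face[OF G cvx(2) u(7,8,1,2,4)] by blast+
  qed
qed

definition pos_part :: "real^'n \<Rightarrow> real^'n" where
  "pos_part x = (\<chi> i. max (x $ i) 0)"

lemma pos_part_nth [simp]: "pos_part x $ i = max (x $ i) 0"
  by (simp add: pos_part_def)

lemma pos_part_diff: "pos_part x - pos_part (- x) = x"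
  by (auto simp: vec_eq_iff)

lemma cone_over_nonneg_vec:
  assumes "(y, l) \<in> cone_over S" "\<And>p. p \<in> S \<Longrightarrow> 0 \<le> (p::real^'n)"
  shows "0 \<le> y"
  using assms by (auto simp: cone_over_iff less_eq_vec_def)

text \<open>Unlike \<open>poly_join_coord_iff\<close>, this description does not mention \<open>J\<close>, so it compares
  joins belonging to different coordinate splittings.\<close>

lemma poly_join_pos_part_iff:
  assumes "convex S" "convex T" "S \<subseteq> coord_space J" "T \<subseteq> coord_space (- J)"
    and nonneg: "\<And>p. p \<in> S \<union> T \<Longrightarrow> 0 \<le> p"
  shows "(x, t) \<in> poly_join S T \<longleftrightarrow>
    (pos_part x, (1 + t) / 2) \<in> cone_over S \<and> (pos_part (- x), (1 - t) / 2) \<in> cone_over T"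
proof -
  have "pos_part x = y \<and> pos_part (- x) = z"
    if "x = y - z" "(y, (1 + t) / 2) \<in> cone_over S" "(z, (1 - t) / 2) \<in> cone_over T" for y z
  proof -
    have "y \<in> coord_space J" "z \<in> coord_space (- J)"
      using that assms cone_over_coord_space by blast+
    moreover have "0 \<le> y" "0 \<le> z" using that cone_over_nonneg_vec nonneg by blast+
    ultimately show ?thesis using that(1)
      by (simp add: vec_eq_iff coord_space_def less_eq_vec_def max_def) (metis ComplI order_antisym_conv)
  qed
  then show ?thesis
    unfolding poly_join_iff[OF assms(1,2)] by (metis pos_part_diff)
qed

lemma anti_blocking_zero: "anti_blocking P \<Longrightarrow> P \<noteq> {} \<Longrightarrow> 0 \<in> P"
  by (auto simp: anti_blocking_def)

lemma cone_over_anti_blocking: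
  assumes "anti_blocking P" "(y, l) \<in> cone_over P" "0 \<le> z" "z \<le> y"
  shows "(z, l) \<in> cone_over P"
proof (cases "l = 0")
  case True
  with assms show ?thesis by (auto simp: cone_over_def)
next
  case False
  with assms have l: "l > 0" "inverse l *\<^sub>R y \<in> P" by (auto simp: cone_over_def)
  then have "inverse l *\<^sub>R z \<le> inverse l *\<^sub>R y" "0 \<le> inverse l *\<^sub>R z"
    using assms(3,4) by (auto simp: less_eq_vec_def mult_left_mono)
  then have "inverse l *\<^sub>R z \<in> P" using l(2) assms(1) unfolding anti_blocking_def by blast
  then show ?thesis using l(1) by (simp add: cone_over_def)
qed

text \<open>Any decomposition \<open>x = y - z\<close> with nonnegative \<open>y\<close>,
  \<open>z\<close> dominates the sign decomposition: \<open>pos_part x \<le> y\<close> and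
  \<open>pos_part (- x) \<le> z\<close>. Anti-blocking, carried over to the cones, allows shrinking
  to it.\<close>

lemma poly_join_anti_blocking_iff:
  assumes "anti_blocking P" "anti_blocking Q"
  shows "(x, t) \<in> poly_join P Q \<longleftrightarrow>
    (pos_part x, (1 + t) / 2) \<in> cone_over P \<and> (pos_part (- x), (1 - t) / 2) \<in> cone_over Q"
proof -
  have cvx: "convex P" "convex Q"
    using assms by (auto simp: anti_blocking_def polytope_imp_convex)
  have "(pos_part x, (1 + t) / 2) \<in> cone_over P \<and> (pos_part (- x), (1 - t) / 2) \<in> cone_over Q"
    if h: "x = y - z" "(y, (1 + t) / 2) \<in> cone_over P" "(z, (1 - t) / 2) \<in> cone_over Q" for y z
  proof -
    have "0 \<le> y" "0 \<le> z" using h assms by (auto intro: cone_over_nonneg_vec simp: anti_blocking_def)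
    then have "pos_part x \<le> y" "pos_part (- x) \<le> z" "0 \<le> pos_part x" "0 \<le> pos_part (- x)"
      by (auto simp: h(1) less_eq_vec_def)
    then show ?thesis using cone_over_anti_blocking assms h by blast
  qed
  then show ?thesis unfolding poly_join_iff[OF cvx] by (metis pos_part_diff)
qed

section \<open>Vertices, affine independence and dimension of joins\<close>

definition join_points :: "(real^'n) set \<Rightarrow> (real^'n) set \<Rightarrow> ((real^'n) \<times> real) set" where
  "join_points V W = V \<times> {1} \<union> uminus ` W \<times> {-1}"

lemma poly_join_eq: "poly_join S T = convex hull (join_points S T)"
  by (simp add: poly_join_def join_points_def)

lemma poly_join_convex_hull: "poly_join (convex hull V) (convex hull W) = poly_join V W"
proof
  show "poly_join V W \<subseteq> poly_join (convex hull V) (convex hull W)"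
    unfolding poly_join_def by (intro hull_mono) (use hull_subset in fast)
  have "(convex hull V) \<times> {1} = convex hull (V \<times> {1::real})"
    by (simp add: convex_hull_Times)
  moreover have "uminus ` (convex hull W) \<times> {-1} = convex hull (uminus ` W \<times> {-1::real})"
    by (simp add: convex_hull_Times convex_hull_linear_image linear_uminus)
  ultimately show "poly_join (convex hull V) (convex hull W) \<subseteq> poly_join V W"
    unfolding poly_join_def
    by (metis Un_least convex_convex_hull hull_minimal hull_mono sup_ge1 sup_ge2)
qed

lemma polytope_poly_join:
  assumes "polytope S" "polytope T"
  shows "polytope (poly_join S T)"
proof -
  obtain V W where "finite V" "S = convex hull V" "finite W" "T = convex hull W"
    using assms unfolding polytope_def by blast
  then show ?thesis
    by (simp add: poly_join_convex_hull) (simp add: poly_join_def polytope_convex_hull)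
qed

lemma sum_join_points:
  assumes "finite V" "finite W"
  shows "sum h (join_points V W) = (\<Sum>v\<in>V. h (v, 1)) + (\<Sum>w\<in>W. h (- w, - 1))"
proof -
  have "sum h (join_points V W) = sum h (V \<times> {1}) + sum h (uminus ` W \<times> {-1})"
    unfolding join_points_def using assms by (intro sum.union_disjoint) auto
  also have "V \<times> {1::real} = (\<lambda>v. (v, 1)) ` V" by auto
  also have "uminus ` W \<times> {-1::real} = (\<lambda>w. (- w, -1)) ` W" by auto
  finally show ?thesis by (simp add: sum.reindex inj_on_def)
qed

lemma finite_join_points: "finite V \<Longrightarrow> finite W \<Longrightarrow> finite (join_points V W)"
  by (simp add: join_points_def)

lemma card_join_points:
  assumes "finite V" "finite W"
  shows "card (join_points V W) = card V + card W"
  using sum_join_points[OF assms, of "\<lambda>_. 1::nat"] by simp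

text \<open>The last coordinate separates the total weight into the two factors, and the disjoint
  supports separate the vector. The weight \<open>s\<close> is free because both affine dependences
  (\<open>s = 0\<close>) and affine coordinates (\<open>s = 1\<close>) are split this way.\<close>

lemma sum_join_points_split:
  fixes k :: "(real^'n) \<times> real \<Rightarrow> real"
  assumes fin: "finite V" "finite W" and J: "V \<subseteq> coord_space J" "W \<subseteq> coord_space (- J)"
    and x: "(\<Sum>p\<in>join_points V W. k p *\<^sub>R p) = (x, t)" and s: "sum k (join_points V W) = s"
  shows "(\<Sum>v\<in>V. k (v, 1) *\<^sub>R v) = coord_proj J x" "(\<Sum>v\<in>V. k (v, 1)) = (s + t) / 2"
    "(\<Sum>w\<in>W. k (- w, - 1) *\<^sub>R w) = - coord_proj (- J) x" "(\<Sum>w\<in>W. k (- w, - 1)) = (s - t) / 2"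
proof -
  let ?y = "\<Sum>v\<in>V. k (v, 1) *\<^sub>R v" and ?z = "\<Sum>w\<in>W. k (- w, - 1) *\<^sub>R w"
  have "(x, t) = (?y - ?z, (\<Sum>v\<in>V. k (v, 1)) - (\<Sum>w\<in>W. k (- w, - 1)))"
    using x unfolding sum_join_points[OF fin]
    by (auto simp: prod_eq_iff fst_sum snd_sum sum_negf)
  then have xe: "x = ?y - ?z" and te: "t = (\<Sum>v\<in>V. k (v, 1)) - (\<Sum>w\<in>W. k (- w, - 1))" by auto
  have "?y \<in> coord_space J" "?z \<in> coord_space (- J)"
    using J by (auto intro!: subspace_sum subspace_scale subspace_coord_space)
  then show "?y = coord_proj J x" "?z = - coord_proj (- J) x"
    by (auto simp: xe vec_eq_iff coord_space_def)
  show "(\<Sum>v\<in>V. k (v, 1)) = (s + t) / 2" "(\<Sum>w\<in>W. k (- w, - 1)) = (s - t) / 2"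
    using s unfolding sum_join_points[OF fin] by (simp_all add: te field_simps)
qed

lemma affine_independent_join_points:
  assumes ind: "\<not> affine_dependent V" "\<not> affine_dependent W"
    and J: "V \<subseteq> coord_space J" "W \<subseteq> coord_space (- J)"
  shows "\<not> affine_dependent (join_points V W)"
proof
  assume dep: "affine_dependent (join_points V W)"
  have fin: "finite V" "finite W" using ind aff_independent_finite by blast+
  then obtain U where U: "sum U (join_points V W) = 0" "\<exists>v\<in>join_points V W. U v \<noteq> 0"
     "(\<Sum>v\<in>join_points V W. U v *\<^sub>R v) = (0, 0)"
    using dep by (auto simp: affine_dependent_explicit_finite finite_join_points zero_prod_def)
  have 0: "coord_proj K 0 = 0" for K by (simp add: vec_eq_iff)
  note * = sum_join_points_split[OF fin J U(3) U(1), unfolded 0]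
  have "\<forall>v\<in>V. U (v, 1) = 0"
    using *(1,2) ind(1)[unfolded affine_dependent_explicit_finite[OF fin(1)] not_ex, rule_format, of "\<lambda>v. U (v, 1)"]
    by simp
  moreover have "\<forall>w\<in>W. U (- w, - 1) = 0"
    using *(3,4) ind(2)[unfolded affine_dependent_explicit_finite[OF fin(2)] not_ex, rule_format, of "\<lambda>w. U (- w, - 1)"]
    by simp
  ultimately have "\<forall>v\<in>V. U (v, 1) = 0" "\<forall>w\<in>W. U (- w, - 1) = 0" by blast+
  then show False using U(2) by (auto simp: join_points_def)
qed

text \<open>Affine bases \<open>V\<close> and \<open>W\<close> of the factors combine to an affine
  basis of the join, so cardinalities add. With dimension -1 for the empty set the formula also
  covers an empty factor.\<close>

lemma aff_dim_poly_join:
  fixes S T :: "(real^'n) set"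
  assumes J: "S \<subseteq> coord_space J" "T \<subseteq> coord_space (- J)"
  shows "aff_dim (poly_join S T) = aff_dim S + aff_dim T + 1"
proof -
  obtain V where V: "V \<subseteq> S" "\<not> affine_dependent V" "affine hull S = affine hull V"
    using affine_basis_exists by blast
  obtain W where W: "W \<subseteq> T" "\<not> affine_dependent W" "affine hull T = affine hull W"
    using affine_basis_exists by blast
  let ?H = "affine hull (join_points V W)"
  \<comment> \<open>A slice of \<open>?H\<close> at fixed height is affine; containing an affine
    basis of a factor, it contains the factor.\<close>
  have "affine {p. (p, 1) \<in> ?H}"
  proof (subst affine_def, intro ballI allI impI)
    fix p q :: "real^'n" and u v :: real
    assume "p \<in> {p. (p, 1) \<in> ?H}" "q \<in> {p. (p, 1) \<in> ?H}" "u + v = 1"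
    then show "u *\<^sub>R p + v *\<^sub>R q \<in> {p. (p, 1) \<in> ?H}"
      using mem_affine[OF affine_affine_hull, of "(p, 1)" "join_points V W" "(q, 1)" u v] by simp
  qed
  then have 1: "(p, 1) \<in> ?H" if "p \<in> S" for p
    using V(3) that hull_inc[of p S affine] hull_minimal[of V "{p. (p, 1) \<in> ?H}" affine]
    by (auto simp: join_points_def intro: hull_inc)
  have "affine {p. (- p, -1) \<in> ?H}"
  proof (subst affine_def, intro ballI allI impI)
    fix p q :: "real^'n" and u v :: real
    assume *: "p \<in> {p. (- p, -1) \<in> ?H}" "q \<in> {p. (- p, -1) \<in> ?H}" "u + v = 1"
    then have "u *\<^sub>R (- p, -1) + v *\<^sub>R (- q, -1) \<in> ?H"
      by (intro mem_affine[OF affine_affine_hull]) auto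
    moreover have "u *\<^sub>R (- p, -1) + v *\<^sub>R (- q, -1) = (- (u *\<^sub>R p + v *\<^sub>R q), - 1 :: real)"
      using *(3) by auto
    ultimately show "u *\<^sub>R p + v *\<^sub>R q \<in> {p. (- p, -1) \<in> ?H}" by simp
  qed
  then have 2: "(- p, -1) \<in> ?H" if "p \<in> T" for p
    using W(3) that hull_inc[of p T affine] hull_minimal[of W "{p. (- p, -1) \<in> ?H}" affine]
    by (auto simp: join_points_def intro: hull_inc)
  have "join_points S T \<subseteq> ?H" using 1 2 by (auto simp: join_points_def)
  moreover have "join_points V W \<subseteq> join_points S T" using V W by (auto simp: join_points_def)
  ultimately have "affine hull (join_points S T) = ?H"
    by (metis affine_affine_hull hull_minimal hull_mono subset_antisym)
  then have "aff_dim (poly_join S T) = aff_dim (join_points V W)"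
    unfolding poly_join_eq aff_dim_convex_hull by (rule aff_dim_affine_hull2)
  also have "\<dots> = int (card (join_points V W)) - 1"
    using aff_dim_affine_independent[OF affine_independent_join_points[OF V(2) W(2), of J]] V(1) W(1) J
    by auto
  also have "\<dots> = (int (card V) - 1) + (int (card W) - 1) + 1"
    using V W by (simp add: card_join_points aff_independent_finite)
  also have "int (card V) - 1 = aff_dim S"
    using aff_dim_unique[of V S] V by simp
  also have "int (card W) - 1 = aff_dim T"
    using aff_dim_unique[of W T] W by simp
  finally show ?thesis .
qed

lemma poly_join_height:
  assumes "convex S" "convex T" "(x, t) \<in> poly_join S T"
  shows "-1 \<le> t" "t \<le> 1"
  using assms(3) unfolding poly_join_iff[OF assms(1,2)] by (auto dest!: cone_over_nonneg)

lemma poly_join_top: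
  assumes "convex S" "convex T"
  shows "S \<times> {1} face_of poly_join S T"
proof -
  have "poly_join S T \<inter> {z. (0, 1) \<bullet> z = 1} face_of poly_join S T"
    using poly_join_height[OF assms]
    by (intro face_of_Int_supporting_hyperplane_le) (auto simp: poly_join_def)
  moreover have "poly_join S T \<inter> {z. (0, 1) \<bullet> z = 1} = S \<times> {1}"
    using assms by (auto simp: poly_join_iff cone_over_iff)
  ultimately show ?thesis by simp
qed

lemma poly_join_bottom:
  assumes "convex S" "convex T"
  shows "uminus ` T \<times> {-1} face_of poly_join S T"
proof -
  have "poly_join S T \<inter> {z. (0, 1) \<bullet> z = -1} face_of poly_join S T"
    using poly_join_height[OF assms]
    by (intro face_of_Int_supporting_hyperplane_ge) (auto simp: poly_join_def)
  moreover have "poly_join S T \<inter> {z. (0, 1) \<bullet> z = -1} = uminus ` T \<times> {-1}"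
    using assms by (auto simp: poly_join_iff cone_over_iff)
  ultimately show ?thesis by simp
qed

lemma verts_face: "F face_of C \<Longrightarrow> verts F = verts C \<inter> F"
  by (auto simp: verts_def extreme_point_of_face)

lemma polytope_eq_hull_verts: "polytope C \<Longrightarrow> C = convex hull (verts C)"
  unfolding verts_def
  by (intro Krein_Milman_Minkowski polytope_imp_compact polytope_imp_convex)

text \<open>The slices at heights 1 and -1 are faces, so vertices of the factors stay extreme in the
  join; conversely, extreme points of a hull are among its generators.\<close>

lemma verts_poly_join:
  assumes "polytope S" "polytope T"
  shows "verts (poly_join S T) = join_points (verts S) (verts T)"
proof
  have "poly_join S T = convex hull (join_points (verts S) (verts T))"
    by (metis assms poly_join_convex_hull poly_join_eq polytope_eq_hull_verts)
  then show "verts (poly_join S T) \<subseteq> join_points (verts S) (verts T)"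
    by (auto simp: verts_def dest: extreme_point_of_convex_hull)
  note cvx = assms[THEN polytope_imp_convex]
  have "{(v, 1)} face_of poly_join S T" if "v extreme_point_of S" for v
    using face_of_trans[OF face_of_Times[of "{v}" S "{1}" "{1}"] poly_join_top[OF cvx]] that
    by (simp add: face_of_singleton)
  moreover have "{(- w, -1)} face_of poly_join S T" if "w extreme_point_of T" for w
  proof -
    have "uminus ` {w} face_of uminus ` T"
      using that by (subst face_of_linear_image) (auto simp: linear_uminus face_of_singleton)
    then show ?thesis
      using face_of_trans[OF face_of_Times[of "{- w}" "uminus ` T" "{-1}" "{-1}"] poly_join_bottom[OF cvx]]
      by (simp add: face_of_singleton)
  qed
  ultimately show "join_points (verts S) (verts T) \<subseteq> verts (poly_join S T)"
    by (auto simp: join_points_def verts_def face_of_singleton)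
qed

text \<open>Zeroing coordinates only decreases a nonnegative point, so by anti-blocking the
  restriction is the projection of \<open>P\<close>, and a full-dimensional set projects onto one
  that spans the coordinate subspace affinely.\<close>

lemma aff_dim_coord_restrict:
  assumes P: "anti_blocking P" "aff_dim P = int CARD('n)"
  shows "aff_dim (coord_restrict P J) = int (card (J :: 'n::finite set))"
proof -
  have "coord_restrict P J = coord_proj J ` P"
  proof
    show "coord_restrict P J \<subseteq> coord_proj J ` P"
      unfolding coord_restrict_eq by (metis IntE coord_proj_eq_iff image_eqI subsetI)
    show "coord_proj J ` P \<subseteq> coord_restrict P J"
    proof
      fix y assume "y \<in> coord_proj J ` P"
      then obtain x where x: "x \<in> P" "y = coord_proj J x" by auto
      then have "0 \<le> x" using P by (auto simp: anti_blocking_def)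
      then have "0 \<le> y" "y \<le> x" by (auto simp: x less_eq_vec_def)
      then have "y \<in> P" using x P unfolding anti_blocking_def by blast
      then show "y \<in> coord_restrict P J"
        by (simp add: coord_restrict_eq x coord_proj_in_coord_space)
    qed
  qed
  also have "affine hull (coord_proj J ` P) = coord_proj J ` (affine hull P)"
    using affine_hull_linear_image linear_coord_proj linear_conv_bounded_linear by metis
  also have "affine hull P = UNIV" using P(2) aff_dim_eq_full[of P] by simp
  also have "range (coord_proj J) = coord_space J"
    by (metis (no_types, lifting) coord_proj_eq_iff coord_proj_in_coord_space image_subsetI rangeI
        subsetI subset_antisym)
  finally have "aff_dim (coord_restrict P J) = aff_dim (coord_space J)"
    using aff_dim_affine_hull[of "coord_restrict P J"] by simp
  then show ?thesis by (simp add: aff_dim_subspace subspace_coord_space dim_coord_space)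
qed

section \<open>Subdivisions of anti-blocking polytopes and their joins\<close>

locale anti_blocking_subdivision =
  fixes P :: "(real^'n) set" and S :: "(real^'n) set set"
  assumes anti: "anti_blocking P" and full: "aff_dim P = int CARD('n)" and sub: "subdivision P S"
begin

lemma nonneg: "x \<in> P \<Longrightarrow> 0 \<le> x"
  using anti by (auto simp: anti_blocking_def)

lemma zero_in: "0 \<in> P"
  using anti_blocking_zero[OF anti] full aff_dim_empty[of P] by force

lemma
  assumes "C \<in> S"
  shows cell_polytope: "polytope C" and cell_subset: "C \<subseteq> P" and cell_convex: "convex C"
  using assms sub polytope_imp_convex by (auto simp: subdivision_def)

lemma restrict_cells_eq: "restrict_cells P S J = (\<lambda>C. C \<inter> coord_space J) ` S"
proof -
  have "C \<inter> coord_restrict P J = C \<inter> coord_space J" if "C \<in> S" for C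
    using cell_subset[OF that] by (auto simp: coord_restrict_eq)
  then show ?thesis by (simp add: restrict_cells_def Setcompr_eq_image)
qed

lemma cell_restrict_face: "C \<in> S \<Longrightarrow> C \<inter> coord_space J face_of C"
  using cell_subset cell_convex nonneg by (intro face_of_Int_coord_space) auto

lemma
  assumes "F \<in> restrict_cells P S J"
  shows restrict_cells_polytope: "polytope F" and restrict_cells_subset: "F \<subseteq> coord_space J"
    and restrict_cells_convex: "convex F" and restrict_cells_subset_P: "F \<subseteq> P"
proof -
  obtain C where C: "C \<in> S" "F = C \<inter> coord_space J" using assms by (auto simp: restrict_cells_eq)
  show "polytope F" using C cell_restrict_face cell_polytope face_of_polytope_polytope by blast
  then show "convex F" by (rule polytope_imp_convex)
  show "F \<subseteq> coord_space J" "F \<subseteq> P" using C cell_subset by auto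
qed

lemma finite_restrict_cells: "finite (restrict_cells P S J)"
  using sub by (simp add: restrict_cells_eq subdivision_def)

text \<open>Two coordinate sets are allowed because joins built from different splittings have to
  meet in faces.\<close>

lemma restrict_cells_Int_face:
  assumes "F \<in> restrict_cells P S J" "G \<in> restrict_cells P S K"
  shows "F \<inter> G face_of F"
proof -
  obtain C D where C: "C \<in> S" "F = C \<inter> coord_space J" and D: "D \<in> S" "G = D \<inter> coord_space K"
    using assms by (auto simp: restrict_cells_eq)
  have "C \<inter> D face_of C" "C \<inter> D face_of D" using C D sub by (auto simp: subdivision_def)
  then show ?thesis
    using face_of_Int_subface cell_restrict_face C D by blast
qed

text \<open>A convex set covered by finitely many closed convex sets is already covered by those of
  its own dimension, here \<open>card J\<close>.\<close>

lemma Union_full_restrict_cells: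
  "\<Union> {F \<in> restrict_cells P S J. aff_dim F = int (card J)} = coord_restrict P J"
proof -
  have "\<Union> (restrict_cells P S J) = coord_restrict P J"
    using sub by (auto simp: restrict_cells_eq subdivision_def coord_restrict_eq)
  moreover have "convex (coord_restrict P J)"
    using anti by (simp add: coord_restrict_eq convex_Int convex_coord_space anti_blocking_def polytope_imp_convex)
  ultimately show ?thesis
    using convex_Union_fulldim_cells[OF finite_restrict_cells, of J "coord_restrict P J"]
      polytope_imp_closed[OF restrict_cells_polytope] restrict_cells_convex
    by (simp add: aff_dim_coord_restrict[OF anti full])
qed

text \<open>A full-dimensional cell \<open>G\<close> through a relative interior point of
  \<open>F\<close> must contain \<open>F\<close>: the face \<open>F \<inter> G\<close> of
  \<open>F\<close> meets the relative interior of \<open>F\<close>. Then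
  \<open>F = G \<inter> F\<close> is a face of \<open>G\<close>.\<close>

lemma full_restrict_cell_exists:
  assumes "F \<in> restrict_cells P S J"
  obtains G where "G \<in> restrict_cells P S J" "aff_dim G = int (card J)" "F face_of G"
proof (cases "F = {}")
  case True
  \<comment> \<open>The empty cell is a face of anything; the origin only serves to show that a
    full-dimensional cell exists.\<close>
  have "0 \<in> coord_restrict P J" using zero_in by (simp add: coord_restrict_def)
  then show ?thesis using that True unfolding Union_full_restrict_cells[symmetric] by auto
next
  case False
  then obtain x where x: "x \<in> rel_interior F"
    using restrict_cells_convex[OF assms] rel_interior_eq_empty by blast
  have "x \<in> coord_restrict P J"
    using x rel_interior_subset restrict_cells_subset[OF assms] restrict_cells_subset_P[OF assms]
    by (auto simp: coord_restrict_eq)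
  then obtain G where G: "G \<in> restrict_cells P S J" "aff_dim G = int (card J)" "x \<in> G"
    unfolding Union_full_restrict_cells[symmetric] by auto
  have "F \<subseteq> F \<inter> G"
    using subset_of_face_of[OF restrict_cells_Int_face[OF assms G(1)], of F] x G(3) rel_interior_subset
    by blast
  then have "F = G \<inter> F" by blast
  then have "F face_of G" using restrict_cells_Int_face[OF G(1) assms] by simp
  then show ?thesis using that G by blast
qed

end

section \<open>The joined cells form a subdivision\<close>

locale joined_subdivisions =
  L1: anti_blocking_subdivision P1 S1 + L2: anti_blocking_subdivision P2 S2
  for P1 P2 :: "(real^'n) set" and S1 S2 :: "(real^'n) set set"
begin

definition Q :: "((real^'n) \<times> real) set" where
  "Q = poly_join P1 P2"

definition all_cells :: "((real^'n) \<times> real) set set" where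
  "all_cells = (\<Union>J. join_cells (restrict_cells P1 S1 J) (restrict_cells P2 S2 (- J)))"

lemma all_cellsI:
  "F \<in> restrict_cells P1 S1 J \<Longrightarrow> G \<in> restrict_cells P2 S2 (- J) \<Longrightarrow> poly_join F G \<in> all_cells"
  unfolding all_cells_def join_cells_def by blast

lemma all_cellsE:
  assumes "C \<in> all_cells"
  obtains J F G where "F \<in> restrict_cells P1 S1 J" "G \<in> restrict_cells P2 S2 (- J)" "C = poly_join F G"
  using assms unfolding all_cells_def join_cells_def by blast

lemma finite_all_cells: "finite all_cells"
proof -
  have "all_cells = (\<Union>J. (\<lambda>(F, G). poly_join F G) ` (restrict_cells P1 S1 J \<times> restrict_cells P2 S2 (- J)))"
    by (fastforce simp: all_cells_def join_cells_def)
  then show ?thesis by (simp add: L1.finite_restrict_cells L2.finite_restrict_cells)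
qed

lemma restricted_pos_part_iff:
  assumes "F \<in> restrict_cells P1 S1 J" "G \<in> restrict_cells P2 S2 (- J)"
  shows "(x, t) \<in> poly_join F G \<longleftrightarrow>
    (pos_part x, (1 + t) / 2) \<in> cone_over F \<and> (pos_part (- x), (1 - t) / 2) \<in> cone_over G"
  using L1.nonneg L2.nonneg L1.restrict_cells_subset_P[OF assms(1)] L2.restrict_cells_subset_P[OF assms(2)]
  by (intro poly_join_pos_part_iff[of _ _ J] L1.restrict_cells_convex[OF assms(1)]
      L2.restrict_cells_convex[OF assms(2)] L1.restrict_cells_subset[OF assms(1)]
      L2.restrict_cells_subset[OF assms(2)]) auto

lemma poly_join_Int_face:
  assumes F: "F \<in> restrict_cells P1 S1 J" "G \<in> restrict_cells P2 S2 (- J)"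
    and F': "F' \<in> restrict_cells P1 S1 K" "G' \<in> restrict_cells P2 S2 (- K)"
  shows "poly_join F G \<inter> poly_join F' G' face_of poly_join F G"
proof -
  note cvx = L1.restrict_cells_convex[OF F(1)] L2.restrict_cells_convex[OF F(2)]
  note J = L1.restrict_cells_subset[OF F(1)] L2.restrict_cells_subset[OF F(2)]
  have face: "F \<inter> F' face_of F" "G \<inter> G' face_of G"
    using L1.restrict_cells_Int_face L2.restrict_cells_Int_face F F' by blast+
  have FF: "convex (F \<inter> F')" "convex (G \<inter> G')" using face face_of_imp_convex by blast+
  have "(x, t) \<in> poly_join (F \<inter> F') (G \<inter> G') \<longleftrightarrow> (x, t) \<in> poly_join F G \<inter> poly_join F' G'" for x t
  proof -
    have "(x, t) \<in> poly_join (F \<inter> F') (G \<inter> G') \<longleftrightarrow>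
      (pos_part x, (1 + t) / 2) \<in> cone_over (F \<inter> F') \<and> (pos_part (- x), (1 - t) / 2) \<in> cone_over (G \<inter> G')"
      using FF J L1.nonneg L2.nonneg L1.restrict_cells_subset_P[OF F(1)] L2.restrict_cells_subset_P[OF F(2)]
      by (intro poly_join_pos_part_iff[of _ _ J]) auto
    then show ?thesis
      unfolding Int_iff restricted_pos_part_iff[OF F] restricted_pos_part_iff[OF F'] cone_over_Int by blast
  qed
  then have "poly_join F G \<inter> poly_join F' G' = poly_join (F \<inter> F') (G \<inter> G')" by auto
  then show ?thesis using face_of_poly_join[OF face cvx J] by simp
qed

lemma all_cells_Int_face:
  assumes "C \<in> all_cells" "D \<in> all_cells"
  shows "C \<inter> D face_of C"
proof -
  obtain J F G where C: "F \<in> restrict_cells P1 S1 J" "G \<in> restrict_cells P2 S2 (- J)" "C = poly_join F G"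
    using assms(1) by (rule all_cellsE)
  obtain K F' G' where D: "F' \<in> restrict_cells P1 S1 K" "G' \<in> restrict_cells P2 S2 (- K)" "D = poly_join F' G'"
    using assms(2) by (rule all_cellsE)
  show ?thesis unfolding C(3) D(3) by (rule poly_join_Int_face[OF C(1,2) D(1,2)])
qed

lemma aff_dim_restricted_join:
  assumes "F \<in> restrict_cells P1 S1 J" "G \<in> restrict_cells P2 S2 (- J)"
  shows "aff_dim (poly_join F G) = aff_dim F + aff_dim G + 1"
  using aff_dim_poly_join L1.restrict_cells_subset L2.restrict_cells_subset assms by blast

lemma full_join:
  assumes "F \<in> restrict_cells P1 S1 J" "G \<in> restrict_cells P2 S2 (- J)"
    and "aff_dim F = int (card J)" "aff_dim G = int (card (- J))"
  shows "aff_dim (poly_join F G) = int DIM((real^'n) \<times> real)"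
proof -
  have "card J + card (- J) = CARD('n)"
    using card_Un_disjoint[of J "- J"] by simp
  then show ?thesis using assms by (simp add: aff_dim_restricted_join)
qed

lemma cell_subset_Q:
  assumes "C \<in> all_cells" shows "C \<subseteq> Q"
  using assms
proof (rule all_cellsE)
  fix J F G
  assume F: "F \<in> restrict_cells P1 S1 J" and G: "G \<in> restrict_cells P2 S2 (- J)" and C: "C = poly_join F G"
  show ?thesis
    unfolding C Q_def poly_join_def
    using L1.restrict_cells_subset_P[OF F] L2.restrict_cells_subset_P[OF G] by (intro hull_mono) auto
qed

lemma Q_covered:
  assumes "z \<in> Q"
  shows "\<exists>C\<in>all_cells. aff_dim C = int DIM((real^'n) \<times> real) \<and> z \<in> C"
proof -
  obtain x t where z: "z = (x, t)" by fastforce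
  \<comment> \<open>The sign pattern of \<open>x\<close> picks the splitting. Zero coordinates fall
    into \<open>- J\<close>, where both parts of \<open>x\<close> vanish anyway.\<close>
  define J where "J = {j. x $ j > 0}"
  have anti: "anti_blocking P1" "anti_blocking P2" by (rule L1.anti L2.anti)+
  have "(pos_part x, (1 + t) / 2) \<in> cone_over P1" "(pos_part (- x), (1 - t) / 2) \<in> cone_over P2"
    using assms poly_join_anti_blocking_iff[OF anti] by (auto simp: z Q_def)
  moreover have "pos_part x \<in> coord_space J" "pos_part (- x) \<in> coord_space (- J)"
    by (auto simp: coord_space_def J_def max_def)
  ultimately have K: "(pos_part x, (1 + t) / 2) \<in> cone_over (coord_restrict P1 J)"
      "(pos_part (- x), (1 - t) / 2) \<in> cone_over (coord_restrict P2 (- J))"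
    by (simp_all add: cone_over_def coord_restrict_eq subspace_scale subspace_coord_space)
  \<comment> \<open>At \<open>t = 1\<close> or \<open>t = -1\<close> one cone point is the apex,
    which lies over every cell; the origin guarantees that a full-dimensional one is
    available.\<close>
  have 0: "0 \<in> coord_restrict P1 J" "0 \<in> coord_restrict P2 (- J)"
    using L1.zero_in L2.zero_in by (simp_all add: coord_restrict_def)
  have "\<exists>F\<in>restrict_cells P1 S1 J. aff_dim F = int (card J) \<and> (pos_part x, (1 + t) / 2) \<in> cone_over F"
    using K(1) 0(1) unfolding L1.Union_full_restrict_cells[symmetric] cone_over_def by auto
  then obtain F where F: "F \<in> restrict_cells P1 S1 J" "aff_dim F = int (card J)"
    "(pos_part x, (1 + t) / 2) \<in> cone_over F" by blast
  have "\<exists>G\<in>restrict_cells P2 S2 (- J). aff_dim G = int (card (- J)) \<and> (pos_part (- x), (1 - t) / 2) \<in> cone_over G"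
    using K(2) 0(2) unfolding L2.Union_full_restrict_cells[symmetric] cone_over_def by auto
  then obtain G where G: "G \<in> restrict_cells P2 S2 (- J)" "aff_dim G = int (card (- J))"
    "(pos_part (- x), (1 - t) / 2) \<in> cone_over G" by blast
  show ?thesis
  proof (intro bexI conjI)
    show "poly_join F G \<in> all_cells" using F(1) G(1) by (rule all_cellsI)
    show "z \<in> poly_join F G" using F G by (simp add: z restricted_pos_part_iff)
    show "aff_dim (poly_join F G) = int DIM((real^'n) \<times> real)" by (rule full_join[OF F(1) G(1) F(2) G(2)])
  qed
qed

lemma aff_dim_Q: "aff_dim Q = int DIM((real^'n) \<times> real)"
proof -
  have "(0, 1) \<in> Q" using L1.zero_in by (auto simp: Q_def poly_join_def intro: hull_inc)
  then obtain C where "C \<in> all_cells" "aff_dim C = int DIM((real^'n) \<times> real)" using Q_covered by blast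
  then show ?thesis
    using aff_dim_subset[OF cell_subset_Q] aff_dim_le_DIM[of Q] by fastforce
qed

lemma full_cells_iff: "C \<in> full_cells Q all_cells \<longleftrightarrow> C \<in> all_cells \<and> aff_dim C = int DIM((real^'n) \<times> real)"
  by (simp add: full_cells_def aff_dim_Q)

lemma subdivision_join: "subdivision Q (full_cells Q all_cells)"
  unfolding subdivision_def
proof (intro conjI ballI)
  show "finite (full_cells Q all_cells)" using finite_all_cells by (simp add: full_cells_def)
  show "\<Union> (full_cells Q all_cells) = Q"
    using Q_covered cell_subset_Q by (force simp: full_cells_iff)
  fix C assume C: "C \<in> full_cells Q all_cells"
  show "aff_dim C = aff_dim Q" using C by (simp add: full_cells_def)
  show "polytope C"
    using C unfolding full_cells_iff
    by (auto elim!: all_cellsE intro!: polytope_poly_join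
        dest: L1.restrict_cells_polytope L2.restrict_cells_polytope)
  fix D assume D: "D \<in> full_cells Q all_cells"
  have "C \<in> all_cells" "D \<in> all_cells" using C D by (simp_all add: full_cells_iff)
  then show "C \<inter> D face_of C" "C \<inter> D face_of D"
    using all_cells_Int_face[of C D] all_cells_Int_face[of D C] by (simp_all add: Int_commute)
qed

text \<open>Passing to maximal cells loses nothing: enlarging both factors to full-dimensional
  restrictions for the same \<open>J\<close> gives a full-dimensional join with the given cell as a
  face.\<close>

lemma face_of_full_cell:
  assumes "C \<in> all_cells"
  shows "\<exists>D\<in>full_cells Q all_cells. C face_of D"
proof -
  obtain J F G where F: "F \<in> restrict_cells P1 S1 J" and G: "G \<in> restrict_cells P2 S2 (- J)"
    and C: "C = poly_join F G"
    using assms by (rule all_cellsE)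
  obtain F' where F': "F' \<in> restrict_cells P1 S1 J" "aff_dim F' = int (card J)" "F face_of F'"
    using L1.full_restrict_cell_exists[OF F] .
  obtain G' where G': "G' \<in> restrict_cells P2 S2 (- J)" "aff_dim G' = int (card (- J))" "G face_of G'"
    using L2.full_restrict_cell_exists[OF G] .
  have "C face_of poly_join F' G'"
    unfolding C
    using face_of_poly_join[OF F'(3) G'(3) L1.restrict_cells_convex L2.restrict_cells_convex
        L1.restrict_cells_subset L2.restrict_cells_subset] F'(1) G'(1) by blast
  moreover have "poly_join F' G' \<in> full_cells Q all_cells"
    using full_join[OF F'(1) G'(1) F'(2) G'(2)] all_cellsI[OF F'(1) G'(1)] by (simp add: full_cells_iff)
  ultimately show ?thesis by blast
qed

lemma all_cell_verts:
  assumes "F \<in> restrict_cells P1 S1 J" "G \<in> restrict_cells P2 S2 (- J)"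
  shows "verts (poly_join F G) = join_points (verts F) (verts G)"
  using assms by (intro verts_poly_join) (auto dest: L1.restrict_cells_polytope L2.restrict_cells_polytope)

end

section \<open>Triangulations and flagness\<close>

lemma (in anti_blocking_subdivision) restrict_cells_verts:
  assumes "F \<in> restrict_cells P S J"
  obtains C where "C \<in> S" "verts F \<subseteq> verts C"
proof -
  obtain C where "C \<in> S" "F = C \<inter> coord_space J" using assms by (auto simp: restrict_cells_eq)
  then show ?thesis using that verts_face[OF cell_restrict_face] by blast
qed

lemma (in anti_blocking_subdivision) restrict_cells_simplex:
  assumes "triangulation S" "F \<in> restrict_cells P S J"
  shows "F = convex hull (verts F)" "\<not> affine_dependent (verts F)"
proof -
  obtain C where C: "C \<in> S" "F face_of C"
    using assms(2) cell_restrict_face by (auto simp: restrict_cells_eq)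
  show "F = convex hull (verts F)"
    by (rule polytope_eq_hull_verts[OF restrict_cells_polytope[OF assms(2)]])
  obtain n where "n simplex C" using assms(1) C by (auto simp: triangulation_def)
  then obtain V where V: "\<not> affine_dependent V" "C = convex hull V" by (auto simp: simplex_def)
  have "verts F \<subseteq> verts C" using verts_face[OF C(2)] by auto
  also have "verts C \<subseteq> V" using extreme_points_of_convex_hull V(2) by (auto simp: verts_def)
  finally show "\<not> affine_dependent (verts F)" using V(1) affine_dependent_subset by blast
qed

context joined_subdivisions begin

lemma triangulation_join:
  assumes "triangulation_of P1 S1" "triangulation_of P2 S2"
  shows "triangulation_of Q (full_cells Q all_cells)"
proof -
  have tri: "triangulation S1" "triangulation S2" using assms by (auto simp: triangulation_of_def)
  have PP: "polytope P1" "polytope P2" using L1.anti L2.anti by (auto simp: anti_blocking_def)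
  have "(\<exists>n. n simplex C) \<and> verts C \<subseteq> verts Q" if cell: "C \<in> all_cells" for C
  proof -
    obtain J F G where F: "F \<in> restrict_cells P1 S1 J" and G: "G \<in> restrict_cells P2 S2 (- J)"
      and C: "C = poly_join F G"
      using cell by (rule all_cellsE)
    have FG: "F = convex hull (verts F)" "G = convex hull (verts G)"
        "\<not> affine_dependent (verts F)" "\<not> affine_dependent (verts G)"
      using L1.restrict_cells_simplex[OF tri(1) F] L2.restrict_cells_simplex[OF tri(2) G] by auto
    have sub: "verts F \<subseteq> coord_space J" "verts G \<subseteq> coord_space (- J)"
      using L1.restrict_cells_subset[OF F] L2.restrict_cells_subset[OF G]
      by (auto simp: verts_def extreme_point_of_def)
    have "C = convex hull (join_points (verts F) (verts G))"
      unfolding C by (metis FG(1,2) poly_join_convex_hull poly_join_eq)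
    then have "int (card (join_points (verts F) (verts G))) - 1 simplex C"
      using affine_independent_join_points[OF FG(3,4) sub] by (simp add: simplex_convex_hull)
    then have "\<exists>n. n simplex C" by blast
    moreover have "verts C \<subseteq> verts Q"
    proof -
      obtain C1 where "C1 \<in> S1" "verts F \<subseteq> verts C1" using L1.restrict_cells_verts[OF F] .
      then have "verts F \<subseteq> verts P1" using assms(1) by (auto simp: triangulation_of_def)
      moreover obtain C2 where "C2 \<in> S2" "verts G \<subseteq> verts C2" using L2.restrict_cells_verts[OF G] .
      then have "verts G \<subseteq> verts P2" using assms(2) by (auto simp: triangulation_of_def)
      ultimately show ?thesis
        unfolding C all_cell_verts[OF F G] Q_def verts_poly_join[OF PP] by (auto simp: join_points_def)
    qed
    ultimately show ?thesis by blast
  qed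
  then show ?thesis
    using subdivision_join unfolding triangulation_of_def triangulation_def
    by (auto simp: subdivision_def full_cells_iff)
qed

end

text \<open>Flagness in clique form: a finite nonface contains an inclusion-minimal one, which has
  two elements and so contradicts \<open>pairs\<close>.\<close>

lemma flag_triangulation_is_face:
  assumes flag: "flag_triangulation P S" and fin: "finite \<sigma>" and V: "\<sigma> \<subseteq> (\<Union>C\<in>S. verts C)"
    and pairs: "\<And>a b. a \<in> \<sigma> \<Longrightarrow> b \<in> \<sigma> \<Longrightarrow> is_face S {a, b}"
  shows "is_face S \<sigma>"
proof (rule ccontr)
  assume "\<not> is_face S \<sigma>"
  with fin have "\<exists>\<tau>\<subseteq>\<sigma>. \<not> is_face S \<tau> \<and> (\<forall>\<rho>. \<rho> \<subset> \<tau> \<longrightarrow> is_face S \<rho>)"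
  proof (induction \<sigma> rule: finite_psubset_induct)
    case (psubset A)
    show ?case
    proof (cases "\<exists>\<rho>. \<rho> \<subset> A \<and> \<not> is_face S \<rho>")
      case True
      then show ?thesis using psubset.IH by (metis order_trans psubset_imp_subset)
    next
      case False
      then show ?thesis using psubset.prems by blast
    qed
  qed
  then obtain \<tau> where \<tau>: "\<tau> \<subseteq> \<sigma>" "\<not> is_face S \<tau>" "\<forall>\<rho>. \<rho> \<subset> \<tau> \<longrightarrow> is_face S \<rho>" by blast
  then have "minimal_nonface S \<tau>" using V by (auto simp: minimal_nonface_def)
  then have "card \<tau> = 2" using flag by (simp add: flag_triangulation_def)
  then obtain a b where "\<tau> = {a, b}" by (auto simp: card_2_iff)
  then show False using \<tau> pairs[of a b] by auto
qed

context joined_subdivisions begin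

lemma flag_join:
  assumes flag: "flag_triangulation P1 S1" "flag_triangulation P2 S2"
  shows "flag_triangulation Q (full_cells Q all_cells)"
proof -
  let ?T = "full_cells Q all_cells"
  \<comment> \<open>Faces may be witnessed by lower-dimensional joins, which is the form in which
    the final witness appears.\<close>
  have is_face_iff: "is_face ?T \<sigma> \<longleftrightarrow> (\<exists>C\<in>all_cells. \<sigma> \<subseteq> verts C)" for \<sigma>
  proof
    assume "is_face ?T \<sigma>"
    then show "\<exists>C\<in>all_cells. \<sigma> \<subseteq> verts C" by (auto simp: is_face_def full_cells_def)
  next
    assume "\<exists>C\<in>all_cells. \<sigma> \<subseteq> verts C"
    then obtain C where C: "C \<in> all_cells" "\<sigma> \<subseteq> verts C" by blast
    obtain D where D: "D \<in> ?T" "C face_of D" using face_of_full_cell[OF C(1)] by blast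
    have "verts C \<subseteq> verts D" using verts_face[OF D(2)] by blast
    then show "is_face ?T \<sigma>" using C D unfolding is_face_def by blast
  qed
  have "card \<sigma> = 2" if min: "minimal_nonface ?T \<sigma>" for \<sigma>
  proof (rule ccontr)
    assume card: "card \<sigma> \<noteq> 2"
    have nonface: "\<not> is_face ?T \<sigma>" and V: "\<sigma> \<subseteq> (\<Union>C\<in>?T. verts C)"
      and sub: "\<And>\<tau>. \<tau> \<subset> \<sigma> \<Longrightarrow> is_face ?T \<tau>"
      using min by (auto simp: minimal_nonface_def)
    have pair: "\<exists>C\<in>all_cells. {a, b} \<subseteq> verts C" if ab: "a \<in> \<sigma>" "b \<in> \<sigma>" for a b
    proof (cases "a = b")
      case True
      obtain C where "C \<in> ?T" "a \<in> verts C" using V ab by blast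
      then show ?thesis using True by (auto simp: full_cells_def)
    next
      case False
      \<comment> \<open>A minimal nonface without exactly two elements properly contains each of its
        pairs, so every pair is a face.\<close>
      then have "{a, b} \<noteq> \<sigma>" using card by auto
      then have "{a, b} \<subset> \<sigma>" using that by auto
      then show ?thesis using sub is_face_iff by blast
    qed
    have pair': "\<exists>J. \<exists>F\<in>restrict_cells P1 S1 J. \<exists>G\<in>restrict_cells P2 S2 (- J).
        {a, b} \<subseteq> join_points (verts F) (verts G)" if ab: "a \<in> \<sigma>" "b \<in> \<sigma>" for a b
    proof -
      obtain C where C: "C \<in> all_cells" "{a, b} \<subseteq> verts C" using pair[OF ab] by blast
      obtain J F G where FG: "F \<in> restrict_cells P1 S1 J" "G \<in> restrict_cells P2 S2 (- J)" "C = poly_join F G"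
        using C(1) by (rule all_cellsE)
      then have "{a, b} \<subseteq> join_points (verts F) (verts G)" using C(2) all_cell_verts[OF FG(1,2)] by simp
      then show ?thesis using FG(1,2) by blast
    qed
    define \<sigma>1 \<sigma>2 where "\<sigma>1 = {v. (v, 1) \<in> \<sigma>}" and "\<sigma>2 = {w. (- w, - 1) \<in> \<sigma>}"
    have \<sigma>: "\<sigma> = join_points \<sigma>1 \<sigma>2"
    proof
      show "\<sigma> \<subseteq> join_points \<sigma>1 \<sigma>2"
      proof
        fix a assume a: "a \<in> \<sigma>"
        with pair'[OF a a] show "a \<in> join_points \<sigma>1 \<sigma>2"
          by (auto simp: join_points_def \<sigma>1_def \<sigma>2_def intro: image_eqI[of _ uminus "- _"])
      qed
    qed (auto simp: join_points_def \<sigma>1_def \<sigma>2_def)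
    have p1: "is_face S1 {v, w}" if vw: "v \<in> \<sigma>1" "w \<in> \<sigma>1" for v w
    proof -
      obtain J F G where "F \<in> restrict_cells P1 S1 J" "{v, w} \<subseteq> verts F"
        using pair'[of "(v, 1)" "(w, 1)"] vw by (auto simp: \<sigma>1_def join_points_def)
      then show ?thesis
        using L1.restrict_cells_verts unfolding is_face_def by (metis order_trans)
    qed
    have p2: "is_face S2 {v, w}" if vw: "v \<in> \<sigma>2" "w \<in> \<sigma>2" for v w
    proof -
      obtain J F G where "G \<in> restrict_cells P2 S2 (- J)" "{v, w} \<subseteq> verts G"
        using pair'[of "(- v, - 1)" "(- w, - 1)"] vw by (auto simp: \<sigma>2_def join_points_def)
      then show ?thesis
        using L2.restrict_cells_verts unfolding is_face_def by (metis order_trans)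
    qed
    have fin_verts: "finite (verts C)" if "polytope C" for C :: "(real^'n) set"
      using finite_polyhedron_extreme_points[OF polytope_imp_polyhedron[OF that]] by (simp add: verts_def)
    have sub1: "\<sigma>1 \<subseteq> (\<Union>C\<in>S1. verts C)" using p1 by (fastforce simp: is_face_def)
    have sub2: "\<sigma>2 \<subseteq> (\<Union>C\<in>S2. verts C)" using p2 by (fastforce simp: is_face_def)
    have "finite (\<Union>C\<in>S1. verts C)" "finite (\<Union>C\<in>S2. verts C)"
      using fin_verts L1.cell_polytope L2.cell_polytope L1.sub L2.sub by (auto simp: subdivision_def)
    then have "is_face S1 \<sigma>1" "is_face S2 \<sigma>2"
      using flag_triangulation_is_face[OF flag(1) _ sub1 p1] flag_triangulation_is_face[OF flag(2) _ sub2 p2]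
        finite_subset[OF sub1] finite_subset[OF sub2] by auto
    then obtain C D where C: "C \<in> S1" "\<sigma>1 \<subseteq> verts C" and D: "D \<in> S2" "\<sigma>2 \<subseteq> verts D"
      by (auto simp: is_face_def)
    \<comment> \<open>The splitting \<open>K\<close> supplied by a pair varies with the pair; the
      union of the supports in the first factor is one choice for all vertices.\<close>
    define J where "J = {j. \<exists>v\<in>\<sigma>1. v $ j \<noteq> 0}"
    have "\<sigma>1 \<subseteq> coord_space J" by (auto simp: coord_space_def J_def)
    moreover have "\<sigma>2 \<subseteq> coord_space (- J)"
    proof -
      \<comment> \<open>The pair formed by \<open>v\<close> and \<open>w\<close> spans a face of a
        join for some \<open>K\<close>, which puts \<open>v\<close> in \<open>K\<close> and
        \<open>w\<close> off \<open>K\<close>.\<close>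
      have "w $ j = 0" if vw: "v \<in> \<sigma>1" "w \<in> \<sigma>2" "v $ j \<noteq> 0" for v w j
      proof -
        obtain K F G where FG: "F \<in> restrict_cells P1 S1 K" "G \<in> restrict_cells P2 S2 (- K)"
          "v \<in> verts F" "w \<in> verts G"
          using pair'[of "(v, 1)" "(- w, - 1)"] vw by (auto simp: \<sigma>1_def \<sigma>2_def join_points_def)
        then have "v \<in> coord_space K" "w \<in> coord_space (- K)"
          using L1.restrict_cells_subset[OF FG(1)] L2.restrict_cells_subset[OF FG(2)]
          by (auto simp: verts_def extreme_point_of_def)
        then show ?thesis using vw(3) by (auto simp: coord_space_def)
      qed
      then show ?thesis by (auto simp: coord_space_def J_def)
    qed
    ultimately have "\<sigma>1 \<subseteq> verts (C \<inter> coord_space J)" "\<sigma>2 \<subseteq> verts (D \<inter> coord_space (- J))"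
      using C D verts_face[OF L1.cell_restrict_face] verts_face[OF L2.cell_restrict_face]
      by (auto simp: verts_def extreme_point_of_def)
    then have "\<sigma> \<subseteq> join_points (verts (C \<inter> coord_space J)) (verts (D \<inter> coord_space (- J)))"
      unfolding \<sigma> by (auto simp: join_points_def)
    moreover have r: "C \<inter> coord_space J \<in> restrict_cells P1 S1 J" "D \<inter> coord_space (- J) \<in> restrict_cells P2 S2 (- J)"
      using C D by (auto simp: L1.restrict_cells_eq L2.restrict_cells_eq)
    ultimately have "is_face ?T \<sigma>"
      unfolding is_face_iff all_cell_verts[OF r, symmetric] using all_cellsI[OF r] by blast
    then show False using nonface by blast
  qed
  moreover have "triangulation_of Q ?T"
    using triangulation_join flag by (simp add: flag_triangulation_def)
  ultimately show ?thesis by (simp add: flag_triangulation_def)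
qed

end

section \<open>Regularity\<close>

lemma face_of_convex_hull_eq_hull_Int:
  fixes V :: "'a::euclidean_space set"
  assumes "finite V" "F face_of convex hull V"
  shows "F = convex hull (V \<inter> F)"
proof -
  obtain V' where V': "V' \<subseteq> V" "F = convex hull V'"
    using face_of_convex_hull_subset[OF finite_imp_compact[OF assms(1)] assms(2)] by blast
  then have "V' \<subseteq> V \<inter> F" using hull_subset by fast
  then have "F \<subseteq> convex hull (V \<inter> F)" using V'(2) hull_mono by metis
  moreover have "convex hull (V \<inter> F) \<subseteq> F"
    using assms(2) by (intro hull_minimal face_of_imp_convex) auto
  ultimately show ?thesis by blast
qed

abbreviation lift :: "('a \<Rightarrow> real) \<Rightarrow> 'a set \<Rightarrow> ('a::euclidean_space \<times> real) set" where
  "lift \<omega> A \<equiv> convex hull ((\<lambda>a. (a, \<omega> a)) ` A)"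

lemma lift_above_iff:
  "(\<forall>(x, t)\<in>lift \<omega> A. c \<bullet> x + b \<le> t) \<longleftrightarrow> (\<forall>a\<in>A. c \<bullet> a + b \<le> \<omega> a)"
proof
  assume "\<forall>(x, t)\<in>lift \<omega> A. c \<bullet> x + b \<le> t"
  then show "\<forall>a\<in>A. c \<bullet> a + b \<le> \<omega> a"
    using hull_subset[of "(\<lambda>a. (a, \<omega> a)) ` A" convex] by auto
next
  assume "\<forall>a\<in>A. c \<bullet> a + b \<le> \<omega> a"
  then have "lift \<omega> A \<subseteq> {z. (- c, 1) \<bullet> z \<ge> b}"
    by (intro hull_minimal convex_halfspace_ge) (auto simp: algebra_simps)
  then show "\<forall>(x, t)\<in>lift \<omega> A. c \<bullet> x + b \<le> t" by (force simp: algebra_simps)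
qed

lemma lower_face_lift:
  assumes "finite A" "\<forall>a\<in>A. c \<bullet> a + b \<le> \<omega> a"
  shows "{(x, t) \<in> lift \<omega> A. t = c \<bullet> x + b} face_of lift \<omega> A" (is "?F face_of _")
    and "fst ` {(x, t) \<in> lift \<omega> A. t = c \<bullet> x + b} = convex hull {a \<in> A. \<omega> a = c \<bullet> a + b}"
proof -
  have ge: "b \<le> (- c, 1) \<bullet> z" if "z \<in> lift \<omega> A" for z
    using assms(2)[folded lift_above_iff] that by (cases z) (force simp: algebra_simps)
  have eq: "?F = lift \<omega> A \<inter> {z. (- c, 1) \<bullet> z = b}" by (auto simp: algebra_simps)
  show face: "?F face_of lift \<omega> A"
    unfolding eq using ge by (intro face_of_Int_supporting_hyperplane_ge) auto
  have "?F = convex hull ((\<lambda>a. (a, \<omega> a)) ` A \<inter> ?F)"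
    using assms(1) by (intro face_of_convex_hull_eq_hull_Int face) auto
  also have "(\<lambda>a. (a, \<omega> a)) ` A \<inter> ?F = (\<lambda>a. (a, \<omega> a)) ` {a \<in> A. \<omega> a = c \<bullet> a + b}"
    using hull_subset[of "(\<lambda>a. (a, \<omega> a)) ` A" convex] by auto
  finally have "fst ` ?F = fst ` (convex hull ((\<lambda>a. (a, \<omega> a)) ` {a \<in> A. \<omega> a = c \<bullet> a + b}))" by simp
  also have "\<dots> = convex hull {a \<in> A. \<omega> a = c \<bullet> a + b}"
    by (simp add: convex_hull_linear_image linear_fst image_image)
  finally show "fst ` ?F = convex hull {a \<in> A. \<omega> a = c \<bullet> a + b}" .
qed

text \<open>The working form of regularity: cells become hulls of the points where an affine
  minorant of the heights is tight, and the lifted polytope need not be handled again when cells are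
  checked.\<close>

lemma lower_face_lift_iff:
  fixes A :: "'a::euclidean_space set"
  assumes "finite A"
  shows "(\<exists>F. E = fst ` F \<and> lower_face (lift \<omega> A) F) \<longleftrightarrow>
    (\<exists>c b. (\<forall>a\<in>A. c \<bullet> a + b \<le> \<omega> a) \<and> E = convex hull {a \<in> A. \<omega> a = c \<bullet> a + b})"
    (is "?L \<longleftrightarrow> ?R")
proof
  assume ?L
  then obtain c b where "\<forall>a\<in>A. c \<bullet> a + b \<le> \<omega> a" "E = fst ` {(x, t)\<in>lift \<omega> A. t = c \<bullet> x + b}"
    unfolding lower_face_def lift_above_iff by blast
  then show ?R using lower_face_lift(2)[OF assms] by blast
next
  assume ?R
  then obtain c b where cb: "\<forall>a\<in>A. c \<bullet> a + b \<le> \<omega> a" "E = convex hull {a \<in> A. \<omega> a = c \<bullet> a + b}"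
    by blast
  then have "E = fst ` {(x, t)\<in>lift \<omega> A. t = c \<bullet> x + b}" using lower_face_lift(2)[OF assms cb(1)] by simp
  moreover have "lower_face (lift \<omega> A) {(x, t)\<in>lift \<omega> A. t = c \<bullet> x + b}"
    unfolding lower_face_def lift_above_iff using cb(1) by blast
  ultimately show ?L by blast
qed

lemma lower_face_polytope:
  assumes "finite A" "lower_face (lift \<omega> A) F"
  shows "polytope (fst ` F)"
proof -
  obtain c b where "\<forall>a\<in>A. c \<bullet> a + b \<le> \<omega> a" "fst ` F = convex hull {a \<in> A. \<omega> a = c \<bullet> a + b}"
    using lower_face_lift_iff[OF assms(1), of "fst ` F"] assms(2) by blast
  then show ?thesis using assms(1) by (simp add: polytope_convex_hull)
qed

text \<open>Above a common point both supporting functions equal the lower boundary. Affine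
  functions that agree on a full-dimensional set are equal.\<close>

lemma lower_face_unique:
  fixes Q :: "('a::euclidean_space \<times> real) set"
  assumes F: "lower_face Q F" and G: "lower_face Q G"
    and dim: "aff_dim (fst ` F \<inter> fst ` G) = int DIM('a)"
  shows "F = G"
proof -
  obtain c b where F: "\<forall>(x, t)\<in>Q. c \<bullet> x + b \<le> t" "F = {(x, t)\<in>Q. t = c \<bullet> x + b}"
    using F by (auto simp: lower_face_def)
  obtain c' b' where G: "\<forall>(x, t)\<in>Q. c' \<bullet> x + b' \<le> t" "G = {(x, t)\<in>Q. t = c' \<bullet> x + b'}"
    using G by (auto simp: lower_face_def)
  have "fst ` F \<inter> fst ` G \<subseteq> {x. (c - c') \<bullet> x = b' - b}"
  proof
    fix x assume "x \<in> fst ` F \<inter> fst ` G"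
    then have "(x, c \<bullet> x + b) \<in> Q" "(x, c' \<bullet> x + b') \<in> Q" by (auto simp: F(2) G(2))
    then have "c' \<bullet> x + b' = c \<bullet> x + b" using F(1) G(1) by fastforce
    then show "x \<in> {x. (c - c') \<bullet> x = b' - b}" by (simp add: algebra_simps)
  qed
  then have "affine hull (fst ` F \<inter> fst ` G) \<subseteq> {x. (c - c') \<bullet> x = b' - b}"
    by (intro hull_minimal affine_hyperplane)
  then have "(c - c') \<bullet> x = b' - b" for x
    using dim unfolding aff_dim_eq_full by blast
  then have "c \<bullet> x + b = c' \<bullet> x + b'" for x
    by (metis add.commute add_diff_cancel_left' diff_add_eq inner_diff_left)
  then show ?thesis by (simp add: F(2) G(2))
qed

text \<open>It suffices that every cell is a projected lower face. The converse inclusion follows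
  because any further full-dimensional lower face would overlap some cell in full dimension, hence
  coincide with it.\<close>

lemma regular_subdivisionI:
  fixes P :: "'a::euclidean_space set"
  assumes sub: "subdivision P S" and full: "aff_dim P = int DIM('a)"
    and A: "finite A" "convex hull A = P"
    and lower: "\<And>C. C \<in> S \<Longrightarrow> \<exists>c b. (\<forall>a\<in>A. c \<bullet> a + b \<le> \<omega> a) \<and> C = convex hull {a \<in> A. \<omega> a = c \<bullet> a + b}"
  shows "regular_subdivision P S"
proof -
  let ?L = "full_cells P {fst ` F | F. lower_face (lift \<omega> A) F}"
  have "S \<subseteq> ?L"
  proof
    fix C assume "C \<in> S"
    then show "C \<in> ?L"
      using lower lower_face_lift_iff[OF A(1), of C \<omega>] sub by (auto simp: full_cells_def subdivision_def)
  qed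
  moreover have "?L \<subseteq> S"
  proof
    fix E assume "E \<in> ?L"
    then obtain F where F: "lower_face (lift \<omega> A) F" "E = fst ` F" "aff_dim E = int DIM('a)"
      using full by (auto simp: full_cells_def)
    have E: "polytope E" using lower_face_polytope[OF A(1) F(1)] F(2) by simp
    have "fst ` lift \<omega> A = P"
      using A(2) by (simp add: convex_hull_linear_image linear_fst image_image)
    then have EP: "E \<subseteq> P" using F(1) unfolding F(2) by (auto simp: lower_face_def)
    \<comment> \<open>The cells of \<open>S\<close> cut \<open>E\<close> into pieces, and some piece
      has the dimension of \<open>E\<close>.\<close>
    have "\<Union> {C \<in> (\<inter>) E ` S. aff_dim C = aff_dim E} = E"
    proof (rule convex_Union_fulldim_cells)
      show "finite ((\<inter>) E ` S)" using sub by (simp add: subdivision_def)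
      show "\<Union> ((\<inter>) E ` S) = E" using EP sub by (auto simp: subdivision_def)
      fix C assume "C \<in> (\<inter>) E ` S"
      then show "closed C" "convex C"
        using E sub by (auto simp: subdivision_def intro: convex_Int polytope_imp_convex polytope_imp_closed)
    qed (use E polytope_imp_convex in blast)
    moreover have "E \<noteq> {}" using F(3) by auto
    ultimately obtain C where C: "C \<in> S" "aff_dim (E \<inter> C) = int DIM('a)" using F(3) by auto
    then obtain G where G: "lower_face (lift \<omega> A) G" "C = fst ` G" using \<open>S \<subseteq> ?L\<close> by (auto simp: full_cells_def)
    then have "F = G" using lower_face_unique F C by metis
    then show "E \<in> S" using C F G by simp
  qed
  ultimately show ?thesis using sub A unfolding regular_subdivision_def by blast
qed

lemma regular_subdivisionE:
  assumes "regular_subdivision P S"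
  obtains A \<omega> c b where "finite A" "convex hull A = P"
    "\<forall>C\<in>S. \<forall>a\<in>A. c C \<bullet> a + b C \<le> \<omega> a"
    "\<forall>C\<in>S. C = convex hull {a \<in> A. \<omega> a = c C \<bullet> a + b C}"
proof -
  obtain A \<omega> where A: "finite A" "convex hull A = P"
    and S: "S = full_cells P {fst ` F | F. lower_face (lift \<omega> A) F}"
    using assms by (auto simp: regular_subdivision_def)
  have "\<forall>C\<in>S. \<exists>c b. (\<forall>a\<in>A. c \<bullet> a + b \<le> \<omega> a) \<and> C = convex hull {a \<in> A. \<omega> a = c \<bullet> a + b}"
    unfolding lower_face_lift_iff[OF A(1), symmetric] S by (auto simp: full_cells_def)
  then obtain c b where "\<forall>C\<in>S. (\<forall>a\<in>A. c C \<bullet> a + b C \<le> \<omega> a) \<and> C = convex hull {a \<in> A. \<omega> a = c C \<bullet> a + b C}"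
    by metis
  then have *: "\<forall>C\<in>S. \<forall>a\<in>A. c C \<bullet> a + b C \<le> \<omega> a"
    "\<forall>C\<in>S. C = convex hull {a \<in> A. \<omega> a = c C \<bullet> a + b C}"
    by blast+
  show ?thesis by (rule that[OF A *])
qed

context joined_subdivisions begin

lemma regular_join:
  assumes "regular_subdivision P1 S1" "regular_subdivision P2 S2"
  shows "regular_subdivision Q (full_cells Q all_cells)"
proof -
  obtain A1 \<omega>1 c1 b1 where A1: "finite A1" "convex hull A1 = P1"
    and le1: "\<forall>C\<in>S1. \<forall>a\<in>A1. c1 C \<bullet> a + b1 C \<le> \<omega>1 a"
    and C1: "\<forall>C\<in>S1. C = convex hull {a \<in> A1. \<omega>1 a = c1 C \<bullet> a + b1 C}"
    using regular_subdivisionE[OF assms(1)] .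
  note le1 = le1[rule_format] and C1 = C1[rule_format]
  obtain A2 \<omega>2 c2 b2 where A2: "finite A2" "convex hull A2 = P2"
    and le2: "\<forall>C\<in>S2. \<forall>a\<in>A2. c2 C \<bullet> a + b2 C \<le> \<omega>2 a"
    and C2: "\<forall>C\<in>S2. C = convex hull {a \<in> A2. \<omega>2 a = c2 C \<bullet> a + b2 C}"
    using regular_subdivisionE[OF assms(2)] .
  note le2 = le2[rule_format] and C2 = C2[rule_format]
  have nonneg: "0 \<le> a" if "a \<in> A1 \<union> A2" for a
    using that A1(2) A2(2) L1.nonneg L2.nonneg hull_subset[of A1 convex] hull_subset[of A2 convex]
    by auto
  \<comment> \<open>A single \<open>M\<close> must beat the slopes of all pairs of cells, hence the
    sums over both subdivisions; the 1 makes the inequality strict.\<close>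
  define M where "M = 1 + (\<Sum>C\<in>S1. norm (c1 C)) + (\<Sum>C\<in>S2. norm (c2 C))"
  have M: "c1 C $ i + c2 D $ i + 2 * M > 0" if "C \<in> S1" "D \<in> S2" for C D i
  proof -
    have "norm (c1 C) \<le> (\<Sum>C\<in>S1. norm (c1 C))" "norm (c2 D) \<le> (\<Sum>D\<in>S2. norm (c2 D))"
      using that L1.sub L2.sub by (auto simp: subdivision_def intro!: member_le_sum)
    then have "norm (c1 C) + norm (c2 D) < M" by (simp add: M_def)
    moreover have "- norm (c1 C) \<le> c1 C $ i" "- norm (c2 D) \<le> c2 D $ i"
      using component_le_norm_cart[of "c1 C" i] component_le_norm_cart[of "c2 D" i] by linarith+
    moreover have "0 \<le> norm (c1 C) + norm (c2 D)" by simp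
    ultimately show ?thesis by linarith
  qed
  \<comment> \<open>The penalty \<open>M\<close> makes the sign-respecting decomposition \<open>x = x\<^sup>+ - x\<^sup>-\<close> the cheapest one.\<close>
  define \<omega> where "\<omega> = (\<lambda>(x, t::real). if t = 1 then \<omega>1 x + M * (\<Sum>i\<in>UNIV. x $ i) else \<omega>2 (- x) + M * (\<Sum>i\<in>UNIV. (- x) $ i))"
  show ?thesis
  proof (rule regular_subdivisionI[OF subdivision_join aff_dim_Q])
    show "finite (join_points A1 A2)" using A1 A2 by (simp add: finite_join_points)
    show "convex hull (join_points A1 A2) = Q"
      unfolding Q_def using A1(2) A2(2) by (metis poly_join_convex_hull poly_join_eq)
    fix E assume "E \<in> full_cells Q all_cells"
    then have "E \<in> all_cells" by (simp add: full_cells_def)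
    then obtain J F G where FG: "F \<in> restrict_cells P1 S1 J" "G \<in> restrict_cells P2 S2 (- J)"
      and E: "E = poly_join F G" by (rule all_cellsE)
    obtain C D where C: "C \<in> S1" "F = C \<inter> coord_space J" and D: "D \<in> S2" "G = D \<inter> coord_space (- J)"
      using FG by (auto simp: L1.restrict_cells_eq L2.restrict_cells_eq)
    define d where "d i = c1 C $ i + c2 D $ i + 2 * M" for i
    have d: "d i > 0" for i using M[OF C(1) D(1)] by (simp add: d_def)
    \<comment> \<open>On \<open>J\<close> the functional follows the slope for height 1, elsewhere
      the one for height -1. Where it follows the wrong one, the shortfall is exactly
      \<open>d i\<close> per unit.\<close>
    define \<gamma> where "\<gamma> = (\<chi> i. if i \<in> J then c1 C $ i + M else - c2 D $ i - M)"
    have g1: "\<gamma> \<bullet> a = c1 C \<bullet> a + M * (\<Sum>i\<in>UNIV. a $ i) - (\<Sum>i\<in>- J. d i * a $ i)" for a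
    proof -
      have "(\<Sum>i\<in>- J. d i * a $ i) = (\<Sum>i\<in>UNIV. if i \<in> - J then d i * a $ i else 0)"
        by (simp add: sum.If_cases Compl_eq)
      then show ?thesis
        by (simp add: inner_vec_def \<gamma>_def sum_distrib_left flip: sum.distrib sum_subtractf)
          (auto intro!: sum.cong simp: d_def algebra_simps)
    qed
    have g2: "\<gamma> \<bullet> (- a) = c2 D \<bullet> a + M * (\<Sum>i\<in>UNIV. a $ i) - (\<Sum>i\<in>J. d i * a $ i)" for a
    proof -
      have "(\<Sum>i\<in>J. d i * a $ i) = (\<Sum>i\<in>UNIV. if i \<in> J then d i * a $ i else 0)"
        by (simp add: sum.If_cases Compl_eq)
      then show ?thesis
        by (simp add: inner_vec_def \<gamma>_def sum_distrib_left flip: sum.distrib sum_subtractf sum_negf)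
          (auto intro!: sum.cong simp: d_def algebra_simps)
    qed
    have pen: "0 \<le> (\<Sum>i\<in>- K. d i * a $ i)" "(\<Sum>i\<in>- K. d i * a $ i) = 0 \<longleftrightarrow> a \<in> coord_space K"
      if "a \<in> A1 \<union> A2" for a K
    proof -
      have n: "0 \<le> d i * a $ i" for i
        using nonneg[OF that] d[of i] by (simp add: less_eq_vec_def)
      then show "0 \<le> (\<Sum>i\<in>- K. d i * a $ i)" by (intro sum_nonneg) auto
      have "(\<Sum>i\<in>- K. d i * a $ i) = 0 \<longleftrightarrow> (\<forall>i\<in>- K. d i * a $ i = 0)"
        using n by (intro sum_nonneg_eq_0_iff) auto
      also have "\<dots> \<longleftrightarrow> a \<in> coord_space K"
        using less_imp_neq[OF d] by (auto simp: coord_space_def)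
      finally show "(\<Sum>i\<in>- K. d i * a $ i) = 0 \<longleftrightarrow> a \<in> coord_space K" .
    qed
    \<comment> \<open>The height component and \<open>b\<close> solve the two equations that make
      the constant term \<open>b1 C\<close> at height 1 and \<open>b2 D\<close> at height
      -1.\<close>
    define c where "c = (\<gamma>, (b1 C - b2 D) / 2)"
    define b where "b = (b1 C + b2 D) / 2"
    have v1: "\<omega> (a, 1) - (c \<bullet> (a, 1) + b) = (\<omega>1 a - (c1 C \<bullet> a + b1 C)) + (\<Sum>i\<in>- J. d i * a $ i)" for a
      by (simp add: \<omega>_def c_def b_def g1 field_simps)
    have v2: "\<omega> (- a, - 1) - (c \<bullet> (- a, - 1) + b) = (\<omega>2 a - (c2 D \<bullet> a + b2 D)) + (\<Sum>i\<in>- (- J). d i * a $ i)" for a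
      unfolding c_def inner_Pair g2 by (simp add: \<omega>_def b_def field_simps)
    \<comment> \<open>By \<open>v1\<close> the slack is a sum of two nonnegative terms, so tightness
      means that \<open>a\<close> is tight for \<open>C\<close> and its penalty vanishes, that is,
      \<open>a\<close> is supported in \<open>J\<close>.\<close>
    have e1: "\<omega> (a, 1) = c \<bullet> (a, 1) + b \<longleftrightarrow> \<omega>1 a = c1 C \<bullet> a + b1 C \<and> a \<in> coord_space J"
      "c \<bullet> (a, 1) + b \<le> \<omega> (a, 1)" if "a \<in> A1" for a
      using v1[of a] le1[OF C(1) that] pen[of a J] that by (simp_all, linarith+)
    have e2: "\<omega> (- a, - 1) = c \<bullet> (- a, - 1) + b \<longleftrightarrow> \<omega>2 a = c2 D \<bullet> a + b2 D \<and> a \<in> coord_space (- J)"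
      "c \<bullet> (- a, - 1) + b \<le> \<omega> (- a, - 1)" if "a \<in> A2" for a
      using v2[of a] le2[OF D(1) that] pen[of a "- J"] that by (simp_all, linarith+)
    have eq: "{p \<in> join_points A1 A2. \<omega> p = c \<bullet> p + b} =
      join_points ({a \<in> A1. \<omega>1 a = c1 C \<bullet> a + b1 C} \<inter> coord_space J)
                  ({a \<in> A2. \<omega>2 a = c2 D \<bullet> a + b2 D} \<inter> coord_space (- J))"
      using e1(1) e2(1) by (auto simp: join_points_def)
    \<comment> \<open>A face of the hull of the tight points is generated by the tight points in it,
      so restricting the cell amounts to restricting its generators.\<close>
    have F_eq: "F = convex hull ({a \<in> A1. \<omega>1 a = c1 C \<bullet> a + b1 C} \<inter> coord_space J)"
    proof -
      have "F face_of convex hull {a \<in> A1. \<omega>1 a = c1 C \<bullet> a + b1 C}"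
        using L1.cell_restrict_face[OF C(1), of J] C1[OF C(1)] C(2) by metis
      from face_of_convex_hull_eq_hull_Int[OF _ this] A1(1)
      have "F = convex hull ({a \<in> A1. \<omega>1 a = c1 C \<bullet> a + b1 C} \<inter> F)" by simp
      also have "{a \<in> A1. \<omega>1 a = c1 C \<bullet> a + b1 C} \<inter> F = {a \<in> A1. \<omega>1 a = c1 C \<bullet> a + b1 C} \<inter> coord_space J"
        using C(2) C1[OF C(1)] hull_subset[of "{a \<in> A1. \<omega>1 a = c1 C \<bullet> a + b1 C}" convex] by blast
      finally show ?thesis .
    qed
    have G_eq: "G = convex hull ({a \<in> A2. \<omega>2 a = c2 D \<bullet> a + b2 D} \<inter> coord_space (- J))"
    proof -
      have "G face_of convex hull {a \<in> A2. \<omega>2 a = c2 D \<bullet> a + b2 D}"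
        using L2.cell_restrict_face[OF D(1), of "- J"] C2[OF D(1)] D(2) by metis
      from face_of_convex_hull_eq_hull_Int[OF _ this] A2(1)
      have "G = convex hull ({a \<in> A2. \<omega>2 a = c2 D \<bullet> a + b2 D} \<inter> G)" by simp
      also have "{a \<in> A2. \<omega>2 a = c2 D \<bullet> a + b2 D} \<inter> G = {a \<in> A2. \<omega>2 a = c2 D \<bullet> a + b2 D} \<inter> coord_space (- J)"
        using D(2) C2[OF D(1)] hull_subset[of "{a \<in> A2. \<omega>2 a = c2 D \<bullet> a + b2 D}" convex] by blast
      finally show ?thesis .
    qed
    have "E = convex hull {p \<in> join_points A1 A2. \<omega> p = c \<bullet> p + b}"
      unfolding E eq by (subst F_eq, subst G_eq) (simp only: poly_join_convex_hull flip: poly_join_eq)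
    moreover have "\<forall>p\<in>join_points A1 A2. c \<bullet> p + b \<le> \<omega> p"
      using e1(2) e2(2) by (auto simp: join_points_def)
    ultimately show "\<exists>c b. (\<forall>p\<in>join_points A1 A2. c \<bullet> p + b \<le> \<omega> p) \<and>
        E = convex hull {p \<in> join_points A1 A2. \<omega> p = c \<bullet> p + b}" by blast
  qed
qed

end

section \<open>Volumes of lattice simplices and unimodularity\<close>

text \<open>An index type for the coordinates of a Euclidean space. It carries a well-order because the
  library's determinant formula for the volume of a simplex is restricted to well-ordered index types.\<close>

typedef (overloaded) 'a dims = "{..<DIM('a::euclidean_space)}"
  by (rule exI[of _ 0]) simp

instantiation dims :: (euclidean_space) wellorder
begin

definition less_eq_dims :: "'a dims \<Rightarrow> 'a dims \<Rightarrow> bool" where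
  "less_eq_dims i j \<longleftrightarrow> Rep_dims i \<le> Rep_dims j"

definition less_dims :: "'a dims \<Rightarrow> 'a dims \<Rightarrow> bool" where
  "less_dims i j \<longleftrightarrow> Rep_dims i < Rep_dims j"

instance
proof
  fix P :: "'a dims \<Rightarrow> bool" and i
  assume *: "\<And>i. (\<And>j. j < i \<Longrightarrow> P j) \<Longrightarrow> P i"
  show "P i"
    by (induction i rule: measure_induct_rule[of Rep_dims]) (auto intro: * simp: less_dims_def)
qed (auto simp: less_eq_dims_def less_dims_def Rep_dims_inject)

end

lemma UNIV_dims: "(UNIV :: 'a dims set) = Abs_dims ` {..<DIM('a::euclidean_space)}"
  using type_definition.univ[OF type_definition_dims] .

instance dims :: (euclidean_space) finite
  by standard (simp add: UNIV_dims)

lemma card_dims [simp]: "CARD('a dims) = DIM('a::euclidean_space)"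
  using type_definition.card[OF type_definition_dims] by simp

definition basis_at :: "'a dims \<Rightarrow> 'a::euclidean_space" where
  "basis_at = (SOME f. bij_betw f UNIV Basis)"

lemma bij_betw_basis_at: "bij_betw basis_at UNIV (Basis :: 'a::euclidean_space set)"
proof -
  have "\<exists>f. bij_betw f (UNIV :: 'a dims set) (Basis :: 'a set)"
    by (intro finite_same_card_bij) auto
  then show ?thesis unfolding basis_at_def by (rule someI_ex)
qed

lemma basis_at_in_Basis: "basis_at i \<in> Basis"
  using bij_betwE[OF bij_betw_basis_at] by blast

lemma inj_basis_at: "inj basis_at"
  using bij_betw_basis_at by (rule bij_betw_imp_inj_on)

lemma inner_basis_at: "basis_at i \<bullet> basis_at j = (if i = j then 1 else 0)"
  by (simp add: inner_Basis basis_at_in_Basis inj_eq[OF inj_basis_at])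

definition to_vec :: "'a::euclidean_space \<Rightarrow> real^('a dims)" where
  "to_vec x = (\<chi> i. x \<bullet> basis_at i)"

definition from_vec :: "real^('a dims) \<Rightarrow> 'a::euclidean_space" where
  "from_vec y = (\<Sum>i\<in>UNIV. y $ i *\<^sub>R basis_at i)"

lemma to_vec_nth [simp]: "to_vec x $ i = x \<bullet> basis_at i"
  by (simp add: to_vec_def)

lemma from_vec_inner [simp]: "from_vec y \<bullet> basis_at i = y $ i"
  by (simp add: from_vec_def inner_sum_left inner_basis_at if_distrib cong: if_cong)

lemma linear_to_vec: "linear to_vec"
  by (rule linearI) (auto simp: vec_eq_iff inner_add_left)

lemma Basis_eq_range: "(Basis :: 'a::euclidean_space set) = range basis_at"
  by (rule bij_betw_imp_surj_on[OF bij_betw_basis_at, symmetric])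

lemma inj_to_vec: "inj to_vec"
  by (rule injI, rule euclidean_eqI) (auto simp: Basis_eq_range vec_eq_iff)

text \<open>Coordinates in an orthonormal basis preserve volume: the preimage of a box is a box with
  the same side lengths.\<close>

lemma lborel_to_vec: "lborel = distr (lborel :: 'a::euclidean_space measure) borel to_vec"
proof (rule lborel_eqI)
  fix l u :: "real^('a dims)" assume lu: "\<And>b. b \<in> Basis \<Longrightarrow> l \<bullet> b \<le> u \<bullet> b"
  have lu': "l $ i \<le> u $ i" for i
    using lu[of "axis i 1"] by (auto simp: inner_axis Basis_vec_def)
  have meas: "to_vec \<in> borel_measurable (borel :: 'a measure)"
    by (intro borel_measurable_continuous_onI linear_continuous_on linear_linear[THEN iffD2, OF linear_to_vec])
  have "emeasure (distr (lborel :: 'a measure) borel to_vec) (box l u) = emeasure lborel (to_vec -` box l u :: 'a set)"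
    using meas by (subst emeasure_distr) auto
  also have "to_vec -` box l u = (box (from_vec l) (from_vec u) :: 'a set)"
    by (auto simp: mem_box_cart mem_box(1)[where 'a='a] Basis_eq_range)
  also have "emeasure lborel \<dots> = (\<Prod>b\<in>Basis. (from_vec u - from_vec l :: 'a) \<bullet> b)"
    using lu' by (intro emeasure_lborel_box) (auto simp: Basis_eq_range)
  also have "(\<Prod>b\<in>Basis. (from_vec u - from_vec l :: 'a) \<bullet> b) = (\<Prod>i\<in>UNIV. u $ i - l $ i)"
    by (subst prod.reindex_bij_betw[OF bij_betw_basis_at, symmetric]) (simp add: inner_diff_left)
  also have "\<dots> = (\<Prod>b\<in>Basis. (u - l) \<bullet> b)"
  proof -
    have "bij_betw (\<lambda>i. axis i (1::real) :: real^('a dims)) UNIV Basis"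
      by (auto simp: bij_betw_def Basis_vec_def inj_on_def axis_eq_axis)
    from prod.reindex_bij_betw[OF this, of "\<lambda>b. (u - l) \<bullet> b"] show ?thesis
      by (simp add: inner_axis)
  qed
  finally show "emeasure (distr (lborel :: 'a measure) borel to_vec) (box l u) = (\<Prod>b\<in>Basis. (u - l) \<bullet> b)" .
qed simp

lemma measure_to_vec:
  fixes C :: "'a::euclidean_space set"
  assumes "compact C"
  shows "measure lebesgue C = measure lborel (to_vec ` C)"
proof -
  have cont: "continuous_on UNIV (to_vec :: 'a \<Rightarrow> _)"
    by (intro linear_continuous_on linear_linear[THEN iffD2, OF linear_to_vec])
  have "compact (to_vec ` C)"
    using assms cont by (intro compact_continuous_image continuous_on_subset[OF cont]) auto
  then have "measure lborel (to_vec ` C) = measure (distr (lborel :: 'a measure) borel to_vec) (to_vec ` C)"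
    using lborel_to_vec by metis
  also have "\<dots> = measure lborel (to_vec -` (to_vec ` C) \<inter> space lborel :: 'a set)"
    using cont \<open>compact (to_vec ` C)\<close>
    by (intro measure_distr) (auto intro: borel_measurable_continuous_onI borel_compact)
  also have "to_vec -` (to_vec ` C) \<inter> space lborel = C"
    by (simp add: inj_vimage_image_eq[OF inj_to_vec])
  finally show ?thesis using assms by (simp add: borel_compact measure_completion)
qed

text \<open>Edges are columns, so that Cramer's rule replaces a single edge and right multiplication
  by an integer matrix recombines edges.\<close>

definition edge_matrix :: "'a::euclidean_space \<Rightarrow> ('a dims \<Rightarrow> 'a) \<Rightarrow> real^('a dims)^('a dims)" where
  "edge_matrix x f = (\<chi> i j. (f j - x) \<bullet> basis_at i)"

lemma measure_simplex:
  fixes X :: "'a::euclidean_space set"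
  assumes X: "finite X" "card X = Suc DIM('a)" "x \<in> X" and f: "bij_betw f UNIV (X - {x})"
  shows "measure lebesgue (convex hull X) = \<bar>det (edge_matrix x f)\<bar> / fact DIM('a)"
proof -
  have inj: "inj_on to_vec A" for A :: "'a set" using inj_to_vec inj_on_subset by blast
  have "measure lebesgue (convex hull X) = measure lborel (convex hull (to_vec ` X))"
    using X(1) by (simp add: measure_to_vec finite_imp_compact_convex_hull convex_hull_linear_image linear_to_vec)
  also have "\<dots> = \<bar>det (\<chi> i j. (to_vec \<circ> f) j $ i - to_vec x $ i)\<bar> / fact CARD('a dims)"
  proof (rule content_simplex)
    show "bij_betw (to_vec \<circ> f) UNIV (to_vec ` X - {to_vec x})"
    proof (rule bij_betw_trans[OF f])
      have "to_vec ` (X - {x}) = to_vec ` X - {to_vec x}"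
        by (simp add: image_set_diff[OF inj_to_vec])
      then show "bij_betw to_vec (X - {x}) (to_vec ` X - {to_vec x})"
        using inj by (simp add: bij_betw_def)
    qed
  qed (use X inj in \<open>auto simp: card_image\<close>)
  also have "(\<chi> i j. (to_vec \<circ> f) j $ i - to_vec x $ i) = edge_matrix x f"
    by (simp add: edge_matrix_def inner_diff_left)
  finally show ?thesis by simp
qed

lemma simplex_measure_pos:
  fixes C :: "'a::euclidean_space set"
  assumes "int DIM('a) simplex C"
  shows "measure lebesgue C > 0"
proof -
  have "affine hull C = UNIV" using aff_dim_simplex[OF assms] by (simp add: aff_dim_eq_full)
  moreover from this have "C \<noteq> {}" by auto
  ultimately have "interior C \<noteq> {}"
    using convex_simplex[OF assms] rel_interior_interior rel_interior_eq_empty by metis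
  then have "\<not> negligible C" using negligible_convex_interior convex_simplex[OF assms] by blast
  moreover have "C \<in> lmeasurable" using compact_simplex[OF assms] by (rule lmeasurable_compact)
  ultimately show ?thesis
    using negligible_iff_measure0 measure_nonneg[of lebesgue C] by (metis order_le_less)
qed

lemma simplex_verts:
  fixes C :: "'a::euclidean_space set"
  assumes "n simplex C"
  shows "finite (verts C)" "\<not> affine_dependent (verts C)" "int (card (verts C)) = n + 1"
    "C = convex hull (verts C)"
proof -
  obtain V where V: "\<not> affine_dependent V" "int (card V) = n + 1" "C = convex hull V"
    using assms by (auto simp: simplex_def)
  then have "verts C = V"
    by (simp add: verts_def extreme_point_of_convex_hull_affine_independent)
  then show "finite (verts C)" "\<not> affine_dependent (verts C)" "int (card (verts C)) = n + 1"
    "C = convex hull (verts C)" using V aff_independent_finite by auto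
qed

lemma full_simplex_edges:
  fixes C :: "'a::euclidean_space set"
  assumes "int DIM('a) simplex C" "x \<in> verts C"
  obtains f where "bij_betw f (UNIV :: 'a dims set) (verts C - {x})"
    "measure lebesgue C = \<bar>det (edge_matrix x f)\<bar> / fact DIM('a)"
proof -
  note V = simplex_verts[OF assms(1)]
  have card: "card (verts C) = Suc DIM('a)" using V(3) by simp
  then have "card (UNIV :: 'a dims set) = card (verts C - {x})"
    using V(1) assms(2) by simp
  then obtain f where f: "bij_betw f (UNIV :: 'a dims set) (verts C - {x})"
    using finite_same_card_bij[of "UNIV :: 'a dims set" "verts C - {x}"] V(1) by auto
  then show ?thesis using that measure_simplex[OF V(1) card assms(2) f] V(4) by metis
qed

section \<open>Minimal volume versus generating the lattice\<close>

lemma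
  fixes \<Lambda> :: "'a::euclidean_space set"
  assumes "full_lattice \<Lambda>"
  shows full_lattice_add: "x \<in> \<Lambda> \<Longrightarrow> y \<in> \<Lambda> \<Longrightarrow> x + y \<in> \<Lambda>"
    and full_lattice_scale: "x \<in> \<Lambda> \<Longrightarrow> of_int k *\<^sub>R x \<in> \<Lambda>"
proof -
  obtain B where L: "\<Lambda> = {\<Sum>b\<in>B. real_of_int (k b) *\<^sub>R b | k :: 'a \<Rightarrow> int. True}"
    using assms by (auto simp: full_lattice_def)
  show "x + y \<in> \<Lambda>" if xy: "x \<in> \<Lambda>" "y \<in> \<Lambda>"
  proof -
    obtain k l :: "'a \<Rightarrow> int" where "x = (\<Sum>b\<in>B. real_of_int (k b) *\<^sub>R b)" "y = (\<Sum>b\<in>B. real_of_int (l b) *\<^sub>R b)"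
      using xy unfolding L by blast
    then have "x + y = (\<Sum>b\<in>B. real_of_int (k b + l b) *\<^sub>R b)"
      by (simp add: scaleR_add_left sum.distrib)
    then have "\<exists>m. x + y = (\<Sum>b\<in>B. real_of_int (m b) *\<^sub>R b)"
      by (rule exI[of _ "\<lambda>b. k b + l b"])
    then show ?thesis unfolding L by simp
  qed
  show "of_int k *\<^sub>R x \<in> \<Lambda>" if x: "x \<in> \<Lambda>"
  proof -
    obtain l :: "'a \<Rightarrow> int" where "x = (\<Sum>b\<in>B. real_of_int (l b) *\<^sub>R b)"
      using x unfolding L by blast
    then have "of_int k *\<^sub>R x = (\<Sum>b\<in>B. real_of_int (k * l b) *\<^sub>R b)"
      by (simp add: scaleR_sum_right)
    then have "\<exists>m. of_int k *\<^sub>R x = (\<Sum>b\<in>B. real_of_int (m b) *\<^sub>R b)"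
      by (rule exI[of _ "\<lambda>b. k * l b"])
    then show ?thesis unfolding L by simp
  qed
qed

text \<open>Passes from affine coordinates on vertices to linear ones on edges at \<open>x\<close>.
  It is applied with total weight 1 for a point minus the base vertex, and with total weight 0 for a
  difference of two points.\<close>

lemma sum_edge_vectors:
  fixes V :: "'a::euclidean_space set" and u :: "'a \<Rightarrow> real"
  assumes "finite V" "x \<in> V" and f: "bij_betw f (UNIV :: 'a dims set) (V - {x})"
  shows "(\<Sum>j\<in>UNIV. u (f j) *\<^sub>R (f j - x)) = (\<Sum>v\<in>V. u v *\<^sub>R v) - sum u V *\<^sub>R x"
proof -
  have "(\<Sum>j\<in>UNIV. u (f j) *\<^sub>R (f j - x)) = (\<Sum>v\<in>V - {x}. u v *\<^sub>R (v - x))"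
    by (rule sum.reindex_bij_betw[OF f])
  also have "\<dots> = (\<Sum>v\<in>V. u v *\<^sub>R (v - x))"
    using assms(1,2) by (simp add: sum.remove)
  finally show ?thesis by (simp add: scaleR_diff_right sum_subtractf scaleR_sum_left)
qed

text \<open>If some affine coordinate of a lattice point were fractional, exchanging the corresponding
  vertex for a lattice point with that coordinate in \<open>(0, 1)\<close> would give a smaller lattice simplex.\<close>

lemma unimodular_simplex_integral_coords:
  fixes C :: "'a::euclidean_space set"
  assumes \<Lambda>: "full_lattice \<Lambda>" and C: "unimodular_simplex \<Lambda> C"
    and s: "sum u (verts C) \<in> \<int>" and u: "(\<Sum>v\<in>verts C. u v *\<^sub>R v) \<in> \<Lambda>" and v: "v \<in> verts C"
  shows "u v \<in> \<int>"
proof (rule ccontr)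
  assume nint: "u v \<notin> \<int>"
  let ?V = "verts C"
  have simp: "int DIM('a) simplex C" and V\<Lambda>: "?V \<subseteq> \<Lambda>"
    and min: "\<And>D. lattice_simplex \<Lambda> D \<Longrightarrow> measure lebesgue C \<le> measure lebesgue D"
    using C by (auto simp: unimodular_simplex_def lattice_simplex_def)
  note V = simplex_verts[OF simp]
  have card: "card ?V = Suc DIM('a)" using V(3) by simp
  \<comment> \<open>The second vertex \<open>y\<close> absorbs the correction of the total weight
    and is the base of the edges, so that \<open>v\<close> is one of the columns.\<close>
  have "?V \<noteq> {v}" using card DIM_positive[where 'a='a] by auto
  then obtain y where y: "y \<in> ?V" "y \<noteq> v" using v by blast
  obtain m where m: "sum u ?V = of_int m" using s by (auto elim: Ints_cases)
  define n where "n = \<lfloor>u v\<rfloor>"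
  define r where "r = u v - of_int n"
  have r: "0 < r" "r < 1"
    using nint by (auto simp: r_def n_def) (metis Ints_of_int floor_correct less_eq_real_def of_int_floor_le, linarith)
  \<comment> \<open>Integral corrections keep the point in the lattice: subtracting \<open>n\<close>
    leaves the fraction \<open>r\<close> at \<open>v\<close>, and adding \<open>n + 1 - m\<close> at
    \<open>y\<close> makes the total weight 1.\<close>
  define \<delta> where "\<delta> = (\<lambda>x. if x = v then - of_int n else if x = y then of_int (n + 1 - m) else (0::real))"
  define u' where "u' = (\<lambda>x. u x + \<delta> x)"
  have \<delta>: "sum \<delta> ?V = 1 - of_int m" "(\<Sum>x\<in>?V. \<delta> x *\<^sub>R x) = of_int (- n) *\<^sub>R v + of_int (n + 1 - m) *\<^sub>R y"
  proof -
    have "sum h ?V = h v + h y" if "\<And>x. x \<noteq> v \<Longrightarrow> x \<noteq> y \<Longrightarrow> h x = 0" for h :: "'a \<Rightarrow> 'b::comm_monoid_add"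
    proof -
      have "sum h {v, y} = sum h ?V"
        using V(1) v y that by (intro sum.mono_neutral_left) auto
      then show ?thesis using y by simp
    qed
    note * = this
    show "sum \<delta> ?V = 1 - of_int m" using y by (subst *) (auto simp: \<delta>_def)
    show "(\<Sum>x\<in>?V. \<delta> x *\<^sub>R x) = of_int (- n) *\<^sub>R v + of_int (n + 1 - m) *\<^sub>R y"
      using y by (subst *) (auto simp: \<delta>_def)
  qed
  define w where "w = (\<Sum>x\<in>?V. u' x *\<^sub>R x)"
  have w: "w = (\<Sum>x\<in>?V. u x *\<^sub>R x) + (of_int (- n) *\<^sub>R v + of_int (n + 1 - m) *\<^sub>R y)"
    unfolding w_def u'_def \<delta>(2)[symmetric] by (simp add: scaleR_add_left sum.distrib)
  have w\<Lambda>: "w \<in> \<Lambda>"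
    unfolding w using u v y V\<Lambda> by (intro full_lattice_add[OF \<Lambda>] full_lattice_scale[OF \<Lambda>]) auto
  have su': "sum u' ?V = 1" by (simp add: u'_def sum.distrib \<delta> m)
  have u'v: "u' v = r" by (simp add: u'_def \<delta>_def r_def)
  \<comment> \<open>The coordinate \<open>r\<close> of \<open>w\<close> at \<open>v\<close> is
    nonzero, so by uniqueness of affine coordinates \<open>w\<close> is off the facet opposite to
    \<open>v\<close> and may replace \<open>v\<close>.\<close>
  have wn: "w \<notin> affine hull (?V - {v})"
  proof
    assume "w \<in> affine hull (?V - {v})"
    then obtain c where c: "sum c (?V - {v}) = 1" "(\<Sum>x\<in>?V - {v}. c x *\<^sub>R x) = w"
      using V(1) by (auto simp: affine_hull_finite)
    define U where "U x = u' x - (if x = v then 0 else c x)" for x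
    have "sum (\<lambda>x. if x = v then 0 else c x) ?V = sum c (?V - {v})"
      using V(1) v by (subst sum.remove[of _ v]) (auto intro: sum.cong)
    then have "sum U ?V = 0" by (simp add: U_def sum_subtractf su' c)
    moreover have "(\<Sum>x\<in>?V. (if x = v then 0 else c x) *\<^sub>R x) = (\<Sum>x\<in>?V - {v}. c x *\<^sub>R x)"
      using V(1) v by (subst sum.remove[of _ v]) (auto intro: sum.cong)
    then have "(\<Sum>x\<in>?V. U x *\<^sub>R x) = 0"
      by (simp add: U_def scaleR_diff_left sum_subtractf c flip: w_def)
    moreover have "U v \<noteq> 0" using r by (simp add: U_def u'v)
    ultimately show False
      using V(2) v unfolding affine_dependent_explicit_finite[OF V(1)] by blast
  qed
  then have wV: "w \<notin> ?V - {v}" using hull_inc by metis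
  define X where "X = insert w (?V - {v})"
  have X: "finite X" "card X = Suc DIM('a)" "y \<in> X"
    using V(1) v y card wV by (auto simp: X_def card_insert_if)
  have indep: "\<not> affine_dependent X"
    unfolding X_def using V(2) wn by (intro affine_independent_insert affine_independent_Diff)
  have "verts (convex hull X) = X"
    using indep by (simp add: verts_def extreme_point_of_convex_hull_affine_independent)
  then have "lattice_simplex \<Lambda> (convex hull X)"
    unfolding lattice_simplex_def using indep X w\<Lambda> V\<Lambda>
    by (auto simp: simplex_convex_hull X_def)
  from min[OF this] have le: "measure lebesgue C \<le> measure lebesgue (convex hull X)" .
  obtain f where f: "bij_betw f (UNIV :: 'a dims set) (?V - {y})"
    and vol: "measure lebesgue C = \<bar>det (edge_matrix y f)\<bar> / fact DIM('a)"
    using full_simplex_edges[OF simp y(1)] .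
  obtain j where j: "f j = v" using f v y by (auto simp: bij_betw_def) (metis imageE insertCI insert_Diff insert_iff)
  have f': "bij_betw (f(j := w)) UNIV (X - {y})"
  proof -
    have inj: "inj f" and im: "range f = ?V - {y}" using f by (auto simp: bij_betw_def)
    have "f ` (UNIV - {j}) = ?V - {y} - {v}"
      using inj im j by (simp add: image_set_diff)
    moreover have "w \<noteq> y" using wV y by auto
    ultimately have "bij_betw f (UNIV - {j}) (?V - {y} - {v})"
      using inj by (auto simp: bij_betw_def intro: inj_on_subset)
    then have "bij_betw (f(j := w)) (UNIV - {j}) (?V - {y} - {v})"
      by (subst bij_betw_cong[of _ _ f]) auto
    moreover have "w \<notin> ?V - {y} - {v}" using wV by auto
    ultimately have "bij_betw (f(j := w)) (insert j (UNIV - {j})) (insert w (?V - {y} - {v}))"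
      by (subst notIn_Un_bij_betw3[of j _ "f(j := w)", simplified, symmetric]) auto
    moreover have "insert w (?V - {y} - {v}) = X - {y}" using \<open>w \<noteq> y\<close> by (auto simp: X_def)
    moreover have "insert j (UNIV - {j}) = UNIV" by auto
    ultimately show ?thesis by simp
  qed
  have "edge_matrix y f *v (\<chi> l. u' (f l)) = (\<chi> i. (w - y) \<bullet> basis_at i)"
  proof -
    have "(edge_matrix y f *v (\<chi> l. u' (f l))) $ i = (w - y) \<bullet> basis_at i" for i
    proof -
      have "(edge_matrix y f *v (\<chi> l. u' (f l))) $ i = (\<Sum>l\<in>UNIV. u' (f l) *\<^sub>R (f l - y)) \<bullet> basis_at i"
        by (simp add: matrix_vector_mult_def edge_matrix_def inner_sum_left mult.commute)
      also have "(\<Sum>l\<in>UNIV. u' (f l) *\<^sub>R (f l - y)) = w - y"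
        using sum_edge_vectors[OF V(1) y(1) f] by (simp add: w_def su')
      finally show ?thesis .
    qed
    then show ?thesis by (simp add: vec_eq_iff)
  qed
  \<comment> \<open>The new column is the old matrix applied to the coordinates of \<open>w\<close>;
    by Cramer's rule the determinant is scaled by the coordinate of \<open>w\<close> at
    \<open>v\<close>, which is \<open>r < 1\<close>.\<close>
  then have "edge_matrix y (f(j := w)) =
      (\<chi> i l. if l = j then (edge_matrix y f *v (\<chi> l. u' (f l))) $ i else edge_matrix y f $ i $ l)"
    by (simp add: vec_eq_iff edge_matrix_def)
  then have "det (edge_matrix y (f(j := w))) = r * det (edge_matrix y f)"
    by (simp add: cramer_lemma j u'v)
  then have "measure lebesgue (convex hull X) = r * measure lebesgue C"
    using measure_simplex[OF X f'] r by (simp add: vol abs_mult)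
  moreover have "measure lebesgue C > 0" by (rule simplex_measure_pos[OF simp])
  ultimately show False using le r by (simp add: mult_less_cancel_right2 leD)
qed

lemma det_in_Ints:
  fixes A :: "real^'m^'m"
  assumes "\<And>i j. A $ i $ j \<in> \<int>"
  shows "det A \<in> \<int>"
  unfolding det_def using assms by (intro Ints_sum Ints_mult Ints_prod) (auto simp: sign_def)

text \<open>Integral coordinates express the edges of any other lattice simplex as an integer matrix
  times the edges of \<open>C\<close>, so its determinant is an integer multiple of that of
  \<open>C\<close>.\<close>

lemma unimodular_simplexI:
  fixes C :: "'a::euclidean_space set"
  assumes C: "lattice_simplex L C"
    and gen: "\<And>z. z \<in> L \<Longrightarrow> \<exists>k. (\<forall>v\<in>verts C. k v \<in> \<int>) \<and> sum k (verts C) = 1 \<and> (\<Sum>v\<in>verts C. k v *\<^sub>R v) = z"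
  shows "unimodular_simplex L C"
  unfolding unimodular_simplex_def
proof (intro conjI allI impI)
  fix D assume D: "lattice_simplex L D"
  have sC: "int DIM('a) simplex C" and sD: "int DIM('a) simplex D" and DL: "verts D \<subseteq> L"
    using C D by (auto simp: lattice_simplex_def)
  have "verts C \<noteq> {}" "verts D \<noteq> {}" using simplex_verts(3)[OF sC] simplex_verts(3)[OF sD] by auto
  then obtain x y where x: "x \<in> verts C" and y: "y \<in> verts D" by blast
  obtain f where f: "bij_betw f (UNIV :: 'a dims set) (verts C - {x})"
    and volC: "measure lebesgue C = \<bar>det (edge_matrix x f)\<bar> / fact DIM('a)"
    using full_simplex_edges[OF sC x] .
  obtain g where g: "bij_betw g (UNIV :: 'a dims set) (verts D - {y})"
    and volD: "measure lebesgue D = \<bar>det (edge_matrix y g)\<bar> / fact DIM('a)"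
    using full_simplex_edges[OF sD y] .
  obtain k where k: "\<forall>z\<in>L. (\<forall>v\<in>verts C. k z v \<in> \<int>) \<and> sum (k z) (verts C) = 1 \<and> (\<Sum>v\<in>verts C. k z v *\<^sub>R v) = z"
    using gen by metis
  have gL: "g j \<in> L" for j using g DL by (auto simp: bij_betw_def)
  have yL: "y \<in> L" using y DL by auto
  \<comment> \<open>The coordinate differences of two lattice points have sum 0, so the coordinate
    at the base vertex \<open>x\<close> drops out.\<close>
  define K :: "real^('a dims)^('a dims)" where "K = (\<chi> i j. k (g j) (f i) - k y (f i))"
  have "edge_matrix y g $ i $ j = (edge_matrix x f ** K) $ i $ j" for i j
  proof -
    have "(edge_matrix x f ** K) $ i $ j = (\<Sum>l\<in>UNIV. (k (g j) (f l) - k y (f l)) *\<^sub>R (f l - x)) \<bullet> basis_at i"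
      by (simp add: matrix_matrix_mult_def edge_matrix_def K_def inner_sum_left mult.commute)
    also have "(\<Sum>l\<in>UNIV. (k (g j) (f l) - k y (f l)) *\<^sub>R (f l - x)) = g j - y"
      using sum_edge_vectors[OF simplex_verts(1)[OF sC] x f, of "\<lambda>v. k (g j) v - k y v"] k gL yL
      by (simp add: scaleR_diff_left sum_subtractf)
    finally show ?thesis by (simp add: edge_matrix_def)
  qed
  then have "edge_matrix y g = edge_matrix x f ** K" by (simp add: vec_eq_iff)
  then have det: "det (edge_matrix y g) = det (edge_matrix x f) * det K" by (simp add: det_mul)
  \<comment> \<open>Positive volume of \<open>D\<close> rules out \<open>det K = 0\<close>, and a
    nonzero integer has absolute value at least 1.\<close>
  have "det (edge_matrix y g) \<noteq> 0" using simplex_measure_pos[OF sD] volD by auto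
  moreover have "f i \<in> verts C" for i using f by (auto simp: bij_betw_def)
  then have "det K \<in> \<int>" using k gL yL by (intro det_in_Ints) (simp add: K_def)
  ultimately have "1 \<le> \<bar>det K\<bar>" using det by (intro Ints_nonzero_abs_ge1) auto
  then show "measure lebesgue C \<le> measure lebesgue D"
    unfolding volC volD det abs_mult by (intro divide_right_mono) (auto simp: mult_le_cancel_left1)
qed (rule C)

text \<open>The set is the translate by \<open>(0, 1)\<close> of the lattice with basis
  \<open>(b, 0)\<close>, for \<open>b\<close> in a basis of \<open>\<Lambda>\<close>, together with
  \<open>(0, 2)\<close>.\<close>

lemma affine_lattice_Times_odd_ints:
  fixes \<Lambda> :: "'a::euclidean_space set"
  assumes "full_lattice \<Lambda>"
  shows "affine_lattice (\<Lambda> \<times> odd_ints)"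
proof -
  obtain B where B: "independent B" "span B = UNIV"
    and L: "\<Lambda> = {\<Sum>b\<in>B. real_of_int (k b) *\<^sub>R b | k :: 'a \<Rightarrow> int. True}"
    using assms by (auto simp: full_lattice_def)
  have finB: "finite B" using B(1) independent_imp_finite by blast
  define B' where "B' = insert (0, 2) ((\<lambda>b. (b, 0::real)) ` B)"
  have lin: "linear (\<lambda>b::'a. (b, 0::real))" by (rule linearI) auto
  have "(x, t) \<in> span B'" for x t
  proof -
    have "(x, 0) \<in> (\<lambda>b. (b, 0)) ` span B" using B(2) by simp
    then have "(x, 0) \<in> span ((\<lambda>b. (b, 0::real)) ` B)" using linear_span_image[OF lin] by metis
    then have "(x, 0) \<in> span B'" unfolding B'_def by (rule span_mono[THEN subsetD, rotated]) auto
    moreover have "(t / 2) *\<^sub>R (0, 2) \<in> span B'" unfolding B'_def by (intro span_scale span_base) auto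
    ultimately have "(x, 0) + (t / 2) *\<^sub>R (0, 2) \<in> span B'" by (rule span_add)
    then show ?thesis by simp
  qed
  then have span: "span B' = UNIV" by auto
  have "card B' = Suc (card B)"
    unfolding B'_def using finB by (subst card_insert_disjoint) (auto simp: card_image inj_on_def)
  also have "card B = DIM('a)" using B by (metis dim_UNIV dim_eq_card_independent dim_span)
  \<comment> \<open>A spanning set with as many vectors as the dimension is independent.\<close>
  finally have indep: "independent B'"
    using span finB by (intro card_le_dim_spanning[of _ UNIV]) (auto simp: B'_def)
  have "(+) (0, 1) ` {\<Sum>b\<in>B'. real_of_int (k b) *\<^sub>R b | k :: 'a \<times> real \<Rightarrow> int. True} = \<Lambda> \<times> odd_ints"
  proof -
    have eq: "(0, 1) + (\<Sum>b\<in>B'. real_of_int (k b) *\<^sub>R b) =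
        (\<Sum>b\<in>B. real_of_int (k (b, 0)) *\<^sub>R b, real_of_int (2 * k (0, 2) + 1))" for k
    proof -
      have "(\<Sum>b\<in>B'. real_of_int (k b) *\<^sub>R b) = real_of_int (k (0, 2)) *\<^sub>R (0, 2) + (\<Sum>b\<in>B. real_of_int (k (b, 0)) *\<^sub>R (b, 0))"
        unfolding B'_def using finB by (subst sum.insert) (auto simp: sum.reindex inj_on_def)
      then show ?thesis by (auto simp: prod_eq_iff fst_sum snd_sum)
    qed
    show ?thesis
    proof
      show "(+) (0, 1) ` {\<Sum>b\<in>B'. real_of_int (k b) *\<^sub>R b | k :: 'a \<times> real \<Rightarrow> int. True} \<subseteq> \<Lambda> \<times> odd_ints"
        unfolding L odd_ints_def by (auto simp: eq simp del: of_int_add of_int_mult)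
      show "\<Lambda> \<times> odd_ints \<subseteq> (+) (0, 1) ` {\<Sum>b\<in>B'. real_of_int (k b) *\<^sub>R b | k :: 'a \<times> real \<Rightarrow> int. True}"
      proof clarify
        fix x t assume "x \<in> \<Lambda>" "t \<in> odd_ints"
        then obtain l :: "'a \<Rightarrow> int" and m where l: "x = (\<Sum>b\<in>B. real_of_int (l b) *\<^sub>R b)" and m: "t = real_of_int (2 * m + 1)"
          unfolding L odd_ints_def by (auto elim!: oddE)
        define k where "k = (\<lambda>(b::'a, s::real). if s = 0 then l b else m)"
        have "(x, t) = (0, 1) + (\<Sum>b\<in>B'. real_of_int (k b) *\<^sub>R b)"
          unfolding eq by (simp add: k_def l m)
        then show "(x, t) \<in> (+) (0, 1) ` {\<Sum>b\<in>B'. real_of_int (k b) *\<^sub>R b | k :: 'a \<times> real \<Rightarrow> int. True}"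
          by blast
      qed
    qed
  qed
  moreover have "full_lattice {\<Sum>b\<in>B'. real_of_int (k b) *\<^sub>R b | k :: 'a \<times> real \<Rightarrow> int. True}"
    unfolding full_lattice_def using span indep by blast
  ultimately show ?thesis unfolding affine_lattice_def by (metis (lifting))
qed

context joined_subdivisions begin

lemma unimodular_join:
  assumes \<Lambda>: "full_lattice \<Lambda>" and split: "coordinate_split \<Lambda>"
    and uni: "unimodular_triangulation \<Lambda> P1 S1" "unimodular_triangulation \<Lambda> P2 S2"
  shows "unimodular_triangulation (\<Lambda> \<times> odd_ints) Q (full_cells Q all_cells)"
proof -
  have tri: "triangulation_of Q (full_cells Q all_cells)"
    using triangulation_join uni by (simp add: unimodular_triangulation_def)
  have neg: "- x \<in> \<Lambda>" if "x \<in> \<Lambda>" for x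
    using full_lattice_scale[OF \<Lambda> that, of "-1"] by simp
  \<comment> \<open>This is where \<open>coordinate_split\<close> enters: the part of a lattice
    point seen by each factor must again be a lattice point.\<close>
  have proj: "coord_proj J x \<in> \<Lambda>" if "x \<in> \<Lambda>" for x J
    using split that by (simp add: coordinate_split_def coord_proj_def)
  \<comment> \<open>The factors of a join are only faces of unimodular simplices; padding the
    coefficients with 0 on the other vertices brings them under the result for full
    simplices.\<close>
  have ext: "u v \<in> \<int>"
    if C: "unimodular_simplex \<Lambda> C" and V: "V \<subseteq> verts C" "v \<in> V"
      and u: "sum u V \<in> \<int>" "(\<Sum>v\<in>V. u v *\<^sub>R v) \<in> \<Lambda>" for u :: "real^'n \<Rightarrow> real" and v V C
  proof -
    define u' where "u' x = (if x \<in> V then u x else 0)" for x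
    have fin: "finite (verts C)"
      using C simplex_verts(1) by (auto simp: unimodular_simplex_def lattice_simplex_def)
    have "sum u' (verts C) = sum u V"
      using fin V(1) by (intro sum.mono_neutral_cong_right) (auto simp: u'_def)
    moreover have "(\<Sum>v\<in>verts C. u' v *\<^sub>R v) = (\<Sum>v\<in>V. u v *\<^sub>R v)"
      using fin V(1) by (intro sum.mono_neutral_cong_right) (auto simp: u'_def)
    ultimately have "u' v \<in> \<int>"
      using unimodular_simplex_integral_coords[OF \<Lambda> C, of u' v] u V by auto
    then show ?thesis using V by (simp add: u'_def)
  qed
  have "unimodular_simplex (\<Lambda> \<times> odd_ints) E" if E: "E \<in> full_cells Q all_cells" for E
  proof -
    have "E \<in> all_cells" and dimE: "aff_dim E = int DIM((real^'n) \<times> real)" using E by (auto simp: full_cells_iff)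
    from this(1) obtain J F G where F: "F \<in> restrict_cells P1 S1 J" and G: "G \<in> restrict_cells P2 S2 (- J)"
      and EFG: "E = poly_join F G" by (rule all_cellsE)
    obtain C where C: "C \<in> S1" "verts F \<subseteq> verts C" using L1.restrict_cells_verts[OF F] .
    obtain D where D: "D \<in> S2" "verts G \<subseteq> verts D" using L2.restrict_cells_verts[OF G] .
    have uC: "unimodular_simplex \<Lambda> C" and uD: "unimodular_simplex \<Lambda> D"
      using uni C D by (auto simp: unimodular_triangulation_def)
    have FG\<Lambda>: "verts F \<subseteq> \<Lambda>" "verts G \<subseteq> \<Lambda>"
      using uC uD C D by (auto simp: unimodular_simplex_def lattice_simplex_def)
    have vE: "verts E = join_points (verts F) (verts G)"
      unfolding EFG by (rule all_cell_verts[OF F G])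
    obtain n where n: "n simplex E" using tri E by (auto simp: triangulation_of_def triangulation_def)
    then have sE: "int DIM((real^'n) \<times> real) simplex E" using aff_dim_simplex[OF n] dimE by simp
    have "(1::real) \<in> odd_ints" "(-1::real) \<in> odd_ints"
      unfolding odd_ints_def mem_Collect_eq by (rule exI[of _ 1], simp, rule exI[of _ "-1"], simp)
    then have "verts E \<subseteq> \<Lambda> \<times> odd_ints"
      using FG\<Lambda> neg unfolding vE by (auto simp: join_points_def)
    then have lat: "lattice_simplex (\<Lambda> \<times> odd_ints) E" using sE by (simp add: lattice_simplex_def)
    have fin: "finite (verts F)" "finite (verts G)"
      using finite_subset[OF C(2)] finite_subset[OF D(2)] uC uD simplex_verts(1)
      unfolding unimodular_simplex_def lattice_simplex_def by blast+
    have sub: "verts F \<subseteq> coord_space J" "verts G \<subseteq> coord_space (- J)"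
      using L1.restrict_cells_subset[OF F] L2.restrict_cells_subset[OF G]
      by (auto simp: verts_def extreme_point_of_def)
    show ?thesis
    proof (rule unimodular_simplexI[OF lat])
      fix z assume z: "z \<in> \<Lambda> \<times> odd_ints"
      then obtain x m where zx: "z = (x, real_of_int (2 * m + 1))" "x \<in> \<Lambda>"
        by (auto simp: odd_ints_def elim!: oddE)
      have "z \<in> affine hull (convex hull (verts E))"
        using simplex_verts(4)[OF sE] dimE unfolding aff_dim_eq_full by simp
      then have "z \<in> affine hull (join_points (verts F) (verts G))" by (simp add: vE)
      then obtain k where k: "sum k (join_points (verts F) (verts G)) = 1"
        "(\<Sum>p\<in>join_points (verts F) (verts G). k p *\<^sub>R p) = z"
        using affine_hull_finite[OF finite_join_points[OF fin]] by auto
      note sp = sum_join_points_split[OF fin sub k(2)[unfolded zx(1)] k(1)]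
      \<comment> \<open>Total weight 1 and height \<open>2 * m + 1\<close> leave the weights
        \<open>m + 1\<close> and \<open>- m\<close>. They are integers because the height is odd; as
        they need not be 1, integrality of coordinates was proved for any integral total
        weight.\<close>
      have s1: "(\<Sum>v\<in>verts F. k (v, 1)) = real_of_int (m + 1)"
        and s2: "(\<Sum>v\<in>verts G. k (- v, - 1)) = real_of_int (- m)"
        using sp(2,4) by (simp_all add: field_simps)
      have i1: "k (v, 1) \<in> \<int>" if "v \<in> verts F" for v
        using ext[OF uC C(2) that, of "\<lambda>v. k (v, 1)"] sp(1) s1 proj[OF zx(2)] by (metis Ints_of_int)
      have i2: "k (- v, - 1) \<in> \<int>" if "v \<in> verts G" for v
        using ext[OF uD D(2) that, of "\<lambda>v. k (- v, - 1)"] sp(3) s2 neg[OF proj[OF zx(2)]]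
        by (metis Ints_of_int)
      show "\<exists>k. (\<forall>v\<in>verts E. k v \<in> \<int>) \<and> sum k (verts E) = 1 \<and> (\<Sum>v\<in>verts E. k v *\<^sub>R v) = z"
        unfolding vE using k i1 i2 by (intro exI[of _ k]) (auto simp: join_points_def)
    qed
  qed
  then show ?thesis
    using tri affine_lattice_Times_odd_ints[OF \<Lambda>] by (simp add: unimodular_triangulation_def)
qed

end

text \<open>Since \<open>subdivision\<close> records maximal cells, the claims are about
  \<open>full_cells Q \<S>\<close>, and the second conjunct accounts for the remaining members of
  the union as faces. In the lattice part, being a triangulation is stated separately from
  unimodularity, which is claimed under \<open>coordinate_split\<close> because of the
  counterexample described at that definition.\<close>

theorem theorem3p18:
  fixes P1 P2 :: "(real^'n) set" and S1 S2 :: "(real^'n) set set"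
  defines "Q \<equiv> poly_join P1 P2"
    and "\<S> \<equiv> (\<Union>J. join_cells (restrict_cells P1 S1 J) (restrict_cells P2 S2 (- J)))"
  assumes "anti_blocking P1" "aff_dim P1 = int CARD('n)" "subdivision P1 S1"
    and "anti_blocking P2" "aff_dim P2 = int CARD('n)" "subdivision P2 S2"
  shows "subdivision Q (full_cells Q \<S>) \<and> (\<forall>C\<in>\<S>. \<exists>D\<in>full_cells Q \<S>. C face_of D)
    \<and> (regular_subdivision P1 S1 \<and> regular_subdivision P2 S2
         \<longrightarrow> regular_subdivision Q (full_cells Q \<S>))
    \<and> (\<forall>\<Lambda>. full_lattice \<Lambda> \<and> unimodular_triangulation \<Lambda> P1 S1 \<and> unimodular_triangulation \<Lambda> P2 S2
         \<longrightarrow> triangulation_of Q (full_cells Q \<S>) \<and>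
             (coordinate_split \<Lambda>
                \<longrightarrow> unimodular_triangulation (\<Lambda> \<times> odd_ints) Q (full_cells Q \<S>)))
    \<and> (flag_triangulation P1 S1 \<and> flag_triangulation P2 S2
         \<longrightarrow> flag_triangulation Q (full_cells Q \<S>))"
proof -
  interpret join: joined_subdivisions P1 P2 S1 S2
    using assms by unfold_locales auto
  have Q: "Q = join.Q" and \<S>: "\<S> = join.all_cells"
    by (simp_all only: Q_def join.Q_def \<S>_def join.all_cells_def)
  show ?thesis
    unfolding Q \<S>
    using join.subdivision_join join.face_of_full_cell join.regular_join join.triangulation_join
      join.unimodular_join join.flag_join
    by (simp add: unimodular_triangulation_def[of _ P1] unimodular_triangulation_def[of _ P2])
qed

end
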